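(* Let $\mathcal I,\mathcal J$ be ideals on $\omega$. If $\mathcal I$ contains a tall summable ideal and Player I has a winning strategy in the game $G(\mathcal J,A,f)$ for all $A\notin\mathcal J$ and all $\mathcal J$-to-one functions $f:A\to\omega$ (in particular, if $\mathcal I$ contains a tall summable ideal and $\mathcal J$ is a Borel ideal such that for each $A\notin\mathcal J$ the ideal $\mathcal J\restriction A$ is not $\le_K$-above any tall summable ideal), then $$\operatorname{cov}(\mathcal M)\le\mathfrak{fip}(\mathcal I,\mathcal J,\omega^\omega).$$
   Context: An ideal on a set $X$ is a family of subsets of $X$ closed under finite unions and subsets, containing all finite subsets of $X$ and not containing $X$; $\mathcal J^+=\mathcal P(X)\setminus\mathcal J$. Borel refers to the topology of $\mathcal P(\omega)\cong\{0,1\}^\omega$. $\operatorname{cov}(\mathcal M)$ is the least number of meager sets covering the real line; $\mathfrak c=2^{\aleph_0}$. A summable ideal is $\mathcal I_g=\{A\subseteq\omega:\sum_{n\in A}g(n)<\infty\}$ with $g:\omega\to[0,\infty)$, $\sum_{n\in\omega}g(n)=\infty$; it is tall (every infinite subset of $\omega$ contains an infinite member) iff $g(n)\to0$. $\mathcal J\restriction A=\{B\cap A:B\in\mathcal J\}$ is an ideal on $A$ for $A\notin\mathcal J$; it is $\le_K$-above $\mathcal I_g$ if there is $f:A\to\omega$ with $f^{-1}[B]\in\mathcal J\restriction A$ for all $B\in\mathcal I_g$. A function $f:A\to\omega$ is $\mathcal J$-to-one if $f^{-1}[\{n\}]\in\mathcal J$ for every $n$. The game $G(\mathcal J,A,f)$: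 first Player I plays $k_0\in\omega$; then, for $n=0,1,2,\dots$, Player II plays a finite set $G_n\subseteq\omega$ and Player I responds with $(F_n,k_{n+1})$, where $F_n\subseteq\omega$ is finite, $F_n\cap G_n=\emptyset$, $|F_n|\le k_n$, and $k_{n+1}\in\omega$. Player I wins iff $f^{-1}[\bigcup_nF_n]\notin\mathcal J\restriction A$; otherwise Player II wins. A nonempty family $\mathcal A\subseteq\mathcal P(\omega)$ has $\mathcal J^+$-FIP if $\bigcap F\in\mathcal J^+$ for each finite $F\subseteq\mathcal A$. $\mathfrak{fip}(\mathcal I,\mathcal J,\mathcal F)$ (for $\mathcal F\subseteq\omega^\omega$) is the minimum of the set consisting of $\mathfrak c^+$ and all cardinals $|\mathcal A|$ such that $\mathcal A\subseteq\mathcal P(\omega)$ has $\mathcal J^+$-FIP and it is not true that for every $f\in\mathcal F$ there is $B\in\mathcal I$ such that $\mathcal A\cup\{f^{-1}[B]\}$ has $\mathcal J^+$-FIP. *)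

theory Defs
  imports "HOL-Analysis.Analysis"
begin

unbundle cardinal_syntax

section \<open>Ideals\<close>

definition ideal_on :: "'a set \<Rightarrow> 'a set set \<Rightarrow> bool" where
  "ideal_on X \<J> \<longleftrightarrow>
     \<J> \<subseteq> Pow X \<and>
     (\<forall>A\<in>\<J>. \<forall>B\<in>\<J>. A \<union> B \<in> \<J>) \<and>
     (\<forall>A\<in>\<J>. \<forall>B. B \<subseteq> A \<longrightarrow> B \<in> \<J>) \<and>
     (\<forall>A. A \<subseteq> X \<and> finite A \<longrightarrow> A \<in> \<J>) \<and>
     X \<notin> \<J>"

definition ideal_restrict :: "'a set set \<Rightarrow> 'a set \<Rightarrow> 'a set set" where
  "ideal_restrict \<J> A = {B \<inter> A | B. B \<in> \<J>}"

definition borel_family :: "nat set set \<Rightarrow> bool" where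
  "borel_family \<J> \<longleftrightarrow> {x :: nat \<Rightarrow> bool. {n. x n} \<in> \<J>} \<in> sets borel"

text \<open>The terms are nonnegative, so \<open>g summable_on A\<close> says that the sum over \<open>A\<close> is finite.\<close>

definition summable_ideal :: "nat set set \<Rightarrow> bool" where
  "summable_ideal \<S> \<longleftrightarrow>
     (\<exists>g :: nat \<Rightarrow> real. (\<forall>n. 0 \<le> g n) \<and> \<not> g summable_on UNIV \<and> \<S> = {A. g summable_on A})"

definition tall :: "nat set set \<Rightarrow> bool" where
  "tall \<S> \<longleftrightarrow> (\<forall>X. infinite X \<longrightarrow> (\<exists>Y\<subseteq>X. infinite Y \<and> Y \<in> \<S>))"

text \<open>
  A function \<open>f : A \<rightarrow> \<omega>\<close> is represented by a total function whose values outside \<open>A\<close>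
  are never used: the preimage of \<open>B\<close> under \<open>f : A \<rightarrow> \<omega>\<close> is \<open>f -` B \<inter> A\<close>.
\<close>

definition katetov_above :: "nat set \<Rightarrow> nat set set \<Rightarrow> nat set set \<Rightarrow> bool" where
  "katetov_above A \<K> \<S> \<longleftrightarrow> (\<exists>f :: nat \<Rightarrow> nat. \<forall>B\<in>\<S>. f -` B \<inter> A \<in> \<K>)"

definition ideal_to_one :: "nat set set \<Rightarrow> nat set \<Rightarrow> (nat \<Rightarrow> nat) \<Rightarrow> bool" where
  "ideal_to_one \<J> A f \<longleftrightarrow> (\<forall>n. f -` {n} \<inter> A \<in> \<J>)"

section \<open>The game\<close>

text \<open>
  A strategy of Player I maps the list of the moves made so far by Player II to Player I's next
  move. It is given by its two components: \<open>\<kappa> [G\<^sub>0, \<dots>, G\<^sub>n\<^sub>-\<^sub>1] = k\<^sub>n\<close>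
  (so \<open>k\<^sub>0 = \<kappa> []\<close>) and \<open>\<phi> [G\<^sub>0, \<dots>, G\<^sub>n] = F\<^sub>n\<close>.
  It is winning if, against every sequence of finite sets, all its moves are legal
  and the resulting run is won by Player I.
\<close>

definition player_I_winning_strategy ::
  "nat set set \<Rightarrow> nat set \<Rightarrow> (nat \<Rightarrow> nat) \<Rightarrow> (nat set list \<Rightarrow> nat) \<Rightarrow> (nat set list \<Rightarrow> nat set) \<Rightarrow> bool"
  where
  "player_I_winning_strategy \<J> A f \<kappa> \<phi> \<longleftrightarrow>
     (\<forall>G :: nat \<Rightarrow> nat set. (\<forall>n. finite (G n)) \<longrightarrow>
        (let k = (\<lambda>n. \<kappa> (map G [0..<n]));
             F = (\<lambda>n. \<phi> (map G [0..<Suc n]))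
         in (\<forall>n. finite (F n) \<and> F n \<inter> G n = {} \<and> card (F n) \<le> k n) \<and>
            f -` (\<Union>n. F n) \<inter> A \<notin> ideal_restrict \<J> A))"

definition player_I_wins :: "nat set set \<Rightarrow> nat set \<Rightarrow> (nat \<Rightarrow> nat) \<Rightarrow> bool" where
  "player_I_wins \<J> A f \<longleftrightarrow> (\<exists>\<kappa> \<phi>. player_I_winning_strategy \<J> A f \<kappa> \<phi>)"

section \<open>Cardinal invariants\<close>

text \<open>
  Cardinals are represented by cardinal well-orders, compared by \<open>\<le>o\<close>; the minimum of a set of
  cardinals is determined up to \<open>=o\<close>.
\<close>

definition min_cardinal :: "'a rel set \<Rightarrow> 'a rel" where
  "min_cardinal R = (SOME r. r \<in> R \<and> (\<forall>s\<in>R. r \<le>o s))"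

lemma min_cardinal:
  assumes "R \<noteq> {}" and "\<And>r. r \<in> R \<Longrightarrow> Card_order r"
  shows min_cardinal_in: "min_cardinal R \<in> R"
    and min_cardinal_le: "s \<in> R \<Longrightarrow> min_cardinal R \<le>o s"
proof -
  have "\<exists>r. r \<in> R \<and> (\<forall>s\<in>R. r \<le>o s)"
    using exists_minim_Card_order[of R] assms by blast
  from someI_ex[OF this]
  show "min_cardinal R \<in> R" and "s \<in> R \<Longrightarrow> min_cardinal R \<le>o s"
    unfolding min_cardinal_def by blast+
qed

definition nowhere_dense :: "'a::topological_space set \<Rightarrow> bool" where
  "nowhere_dense S \<longleftrightarrow> interior (closure S) = {}"

definition meager :: "'a::topological_space set \<Rightarrow> bool" where
  "meager S \<longleftrightarrow> (\<exists>N :: nat \<Rightarrow> 'a set. (\<forall>n. nowhere_dense (N n)) \<and> S = (\<Union>n. N n))"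

text \<open>
  A well-order relation in HOL carries the type of its field, so the cardinals are taken up to
  \<open>=o\<close> among the cardinal orders of one fixed type. Nothing is lost: that type has a
  representative of \<open>|\<C>|\<close> for every family \<open>\<C>\<close> of sets of reals, respectively of \<open>\<cc>\<^sup>+\<close> and of
  \<open>|\<A>|\<close> for every family \<open>\<A>\<close> of sets of naturals.
\<close>

definition cov_meager :: "real set rel" where
  "cov_meager = min_cardinal
     {\<kappa>. Card_order \<kappa> \<and>
         (\<exists>\<C> :: real set set. (\<forall>M\<in>\<C>. meager M) \<and> \<Union>\<C> = UNIV \<and> \<kappa> =o |\<C>| )}"

definition has_FIP :: "nat set set \<Rightarrow> nat set set \<Rightarrow> bool" where
  "has_FIP \<J> \<A> \<longleftrightarrow> \<A> \<noteq> {} \<and> (\<forall>F. finite F \<and> F \<subseteq> \<A> \<longrightarrow> \<Inter>F \<notin> \<J>)"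

definition fip :: "nat set set \<Rightarrow> nat set set \<Rightarrow> (nat \<Rightarrow> nat) set \<Rightarrow> nat set set rel" where
  "fip \<I> \<J> \<F> = min_cardinal
     {\<kappa>. Card_order \<kappa> \<and>
         (\<kappa> =o cardSuc |UNIV :: nat set set| \<or>
          (\<exists>\<A> :: nat set set. has_FIP \<J> \<A> \<and>
             \<not> (\<forall>f\<in>\<F>. \<exists>B\<in>\<I>. has_FIP \<J> (\<A> \<union> {f -` B})) \<and> \<kappa> =o |\<A>| ))}"

text \<open>The minima defining \<open>cov_meager\<close> and \<open>fip\<close> are taken over nonempty sets.\<close>

lemma cov_meager_minimum:
  "(\<exists>\<C> :: real set set. (\<forall>M\<in>\<C>. meager M) \<and> \<Union>\<C> = UNIV \<and> cov_meager =o |\<C>| ) \<and>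
   (\<forall>\<C> :: real set set. (\<forall>M\<in>\<C>. meager M) \<and> \<Union>\<C> = UNIV \<longrightarrow> cov_meager \<le>o |\<C>| )"
proof -
  let ?R = "{\<kappa> :: real set rel. Card_order \<kappa> \<and>
         (\<exists>\<C> :: real set set. (\<forall>M\<in>\<C>. meager M) \<and> \<Union>\<C> = UNIV \<and> \<kappa> =o |\<C>| )}"
  have mem: "|\<C>| \<in> ?R" if "\<forall>M\<in>\<C>. meager M" "\<Union>\<C> = UNIV" for \<C> :: "real set set"
    by (intro CollectI conjI exI[of _ \<C>] card_of_Card_order that card_of_refl)
  have "meager {x}" for x :: real
    unfolding meager_def nowhere_dense_def by (intro exI[of _ "\<lambda>_. {x}"]) auto
  then have "|range (\<lambda>x :: real. {x})| \<in> ?R"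
    by (intro mem) auto
  then have ne: "?R \<noteq> {}" by blast
  have R: "cov_meager \<in> ?R"
    unfolding cov_meager_def by (rule min_cardinal_in[OF ne]) simp
  have le: "cov_meager \<le>o s" if "s \<in> ?R" for s
    unfolding cov_meager_def by (rule min_cardinal_le[OF ne _ that]) simp
  from R have "\<exists>\<C> :: real set set. (\<forall>M\<in>\<C>. meager M) \<and> \<Union>\<C> = UNIV \<and> cov_meager =o |\<C>|"
    by simp
  then show ?thesis using le[OF mem] by simp
qed

lemma fip_minimum:
  fixes \<I> \<J> :: "nat set set" and \<F> :: "(nat \<Rightarrow> nat) set"
  defines "bad \<equiv> \<lambda>\<A>. has_FIP \<J> \<A> \<and> \<not> (\<forall>f\<in>\<F>. \<exists>B\<in>\<I>. has_FIP \<J> (\<A> \<union> {f -` B}))"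
  shows "(fip \<I> \<J> \<F> =o cardSuc |UNIV :: nat set set| \<or> (\<exists>\<A>. bad \<A> \<and> fip \<I> \<J> \<F> =o |\<A>| )) \<and>
         fip \<I> \<J> \<F> \<le>o cardSuc |UNIV :: nat set set| \<and>
         (\<forall>\<A>. bad \<A> \<longrightarrow> fip \<I> \<J> \<F> \<le>o |\<A>| )"
proof -
  let ?R = "{\<kappa> :: nat set set rel. Card_order \<kappa> \<and>
         (\<kappa> =o cardSuc |UNIV :: nat set set| \<or> (\<exists>\<A>. bad \<A> \<and> \<kappa> =o |\<A>| ))}"
  have c: "cardSuc |UNIV :: nat set set| \<in> ?R"
    by (intro CollectI conjI disjI1 cardSuc_Card_order ordIso_refl card_of_Card_order)
  then have ne: "?R \<noteq> {}" by blast
  have eq: "fip \<I> \<J> \<F> = min_cardinal ?R"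
    unfolding fip_def bad_def by (simp add: conj_assoc)
  have R: "fip \<I> \<J> \<F> \<in> ?R"
    unfolding eq by (rule min_cardinal_in[OF ne]) simp
  have le: "fip \<I> \<J> \<F> \<le>o s" if "s \<in> ?R" for s
    unfolding eq by (rule min_cardinal_le[OF ne _ that]) simp
  have "fip \<I> \<J> \<F> \<le>o |\<A>|" if "bad \<A>" for \<A>
  proof -
    have iso: "|(\<lambda>X. {X}) ` \<A>| =o |\<A>|"
      by (intro ordIso_symmetric[OF card_of_ordIsoI] bij_betw_imageI) (auto simp: inj_on_def)
    then have "|(\<lambda>X. {X}) ` \<A>| \<in> ?R"
      by (intro CollectI conjI disjI2 exI[of _ \<A>] card_of_Card_order that)
    from le[OF this] iso show ?thesis
      by (rule ordLeq_ordIso_trans)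
  qed
  with R le[OF c] show ?thesis by simp
qed

end

theory Submission
  imports Defs
begin

text \<open>
  For the bound on \<open>cov(M)\<close>, let \<open>\<A>\<close> be a family with the \<open>\<J>\<^sup>+\<close>-FIP and \<open>f\<close> a function, and suppose that no
  \<open>B \<in> \<I>\<close> can be added through \<open>f\<close>. Let \<open>g\<close> be the weight of the tall summable ideal in \<open>\<I>\<close>. A
  point \<open>x\<close> of \<open>\<omega>\<^sup>\<omega>\<close> codes a union of finite sets whose \<open>a\<close>-th member has weight at most \<open>2\<^sup>-\<^sup>a\<close>, so the union lies
  in \<open>\<I>\<close>. On a finite intersection \<open>A\<close> of members of \<open>\<A>\<close> where \<open>f\<close> is \<open>\<J>\<close>-to-one, Player II can force the moves
  \<open>F\<^sub>n\<close> of a winning strategy of Player I to be as light as desired, since \<open>g\<close> tends to \<open>0\<close>. So countably many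
  requirements of the form \<open>\<exists>a. x a = c a\<close> ensure that the union contains a run won by Player I, and its preimage
  is positive on \<open>A\<close> (\<open>generic_set_positive\<close>). Where \<open>f\<close> has positive fibres, it is enough to meet an infinite
  set or to add finitely many points. Each requirement fails only on a nowhere dense set of
  reals (\<open>nowhere_dense_real_to_baire_neq\<close>). The resulting meager sets, at most \<open>|\<A>|\<close> many, cover
  the line, because a real outside of them would yield a set \<open>B\<close> as excluded by the choice of \<open>\<A>\<close> and \<open>f\<close>
  (\<open>cov_meager_le_card_bad_family\<close>).

  For a Borel ideal \<open>\<J>\<close> the existence of winning strategies is shown without Borel determinacy.
  The collection of sets with positive preimage is a projection of a closed set. In the unfolded
  game Player I also announces, one by one, the values of a witness for membership in this projection. An
  announcement may be postponed, but in round \<open>n\<close> its value may not exceed \<open>n\<close>. Player I wins if there are infinitely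
  many announcements, and games with winning conditions of this kind are determined by an elementary argument
  (\<open>buchi_determinacy\<close>). If Player I wins the unfolded game, then Player I wins the original one. If Player II has a
  winning strategy, then, because only finitely many announcements are possible at each stage, there is a sequence of
  intervals that outgrows all answers of the strategy. Every set that is thin with respect to the
  intervals then has its preimage in \<open>\<J>\<close>, since Player I could otherwise play the set together with its witness
  (\<open>thin_not_in_projection\<close>). The members of a suitable tall summable ideal are thin up to finite sets, so \<open>\<J> \<restriction> A\<close> is
  Katetov-above that ideal, contrary to the hypothesis (\<open>player_II_katetov\<close>).
\<close>

section \<open>Sums and tall summable ideals\<close>

lemma summable_on_small_tail:
  fixes g :: "'a \<Rightarrow> real"
  assumes g: "\<And>n. 0 \<le> g n" and sm: "g summable_on B" and e: "e > 0"
  obtains F0 where "finite F0" "F0 \<subseteq> B" "\<And>F. finite F \<Longrightarrow> F \<subseteq> B - F0 \<Longrightarrow> sum g F \<le> e"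
proof -
  obtain s where s: "(g has_sum s) B" using sm unfolding summable_on_def by blast
  obtain F0 where F0: "finite F0" "F0 \<subseteq> B" "dist (sum g F0) s \<le> e"
    using has_sum_finite_approximation[OF s e] by blast
  have "sum g F \<le> e" if F: "finite F" "F \<subseteq> B - F0" for F
  proof -
    have "sum g (F0 \<union> F) \<le> s"
      by (rule finite_sum_le_has_sum[OF s]) (use F F0 g in auto)
    moreover have "sum g (F0 \<union> F) = sum g F0 + sum g F"
      by (rule sum.union_disjoint) (use F F0 in auto)
    ultimately show ?thesis using F0(3) unfolding dist_real_def by linarith
  qed
  then show thesis using that F0 by blast
qed

lemma summable_on_UN_geometric:
  fixes g :: "nat \<Rightarrow> real"
  assumes g: "\<And>n. 0 \<le> g n"
    and D: "\<And>a. finite (D a)" "\<And>a. sum g (D a) \<le> (1/2) ^ a"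
  shows "g summable_on (\<Union>a. D a)"
proof -
  have UN: "sum g (\<Union>a<N. D a) \<le> (\<Sum>a<N. sum g (D a))" for N
  proof (induction N)
    case (Suc N)
    let ?X = "\<Union>a<N. D a"
    have "sum g (?X \<union> D N) + sum g (?X \<inter> D N) = sum g ?X + sum g (D N)"
      by (rule sum.union_inter) (use D in auto)
    moreover have "sum g (?X \<inter> D N) \<ge> 0" by (rule sum_nonneg) (rule g)
    ultimately show ?case using Suc by (simp add: lessThan_Suc Un_commute)
  qed simp
  show ?thesis
  proof (rule nonneg_bdd_above_summable_on)
    show "bdd_above (sum g ` {F. F \<subseteq> (\<Union>a. D a) \<and> finite F})"
    proof (rule bdd_aboveI2)
      fix F assume "F \<in> {F. F \<subseteq> (\<Union>a. D a) \<and> finite F}"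
      then have F: "finite F" "\<forall>x\<in>F. \<exists>a. x \<in> D a" by auto
      from F(2) obtain h where h: "\<And>x. x \<in> F \<Longrightarrow> x \<in> D (h x)" by metis
      obtain N where N: "h ` F \<subseteq> {..<N}"
        using F(1) by (meson finite_imageI finite_nat_iff_bounded)
      have FN: "F \<subseteq> (\<Union>a<N. D a)"
      proof
        fix x assume "x \<in> F"
        then show "x \<in> (\<Union>a<N. D a)" using h[of x] N by blast
      qed
      have "sum g F \<le> sum g (\<Union>a<N. D a)"
        by (rule sum_mono2) (use FN D g in auto)
      also have "\<dots> \<le> (\<Sum>a<N. sum g (D a))"
        by (rule UN)
      also have "\<dots> \<le> (\<Sum>a<N. (1/2) ^ a)" by (rule sum_mono) (rule D(2))
      also have "\<dots> \<le> (2::real)" by (simp add: geometric_sum)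
      finally show "sum g F \<le> 2" .
    qed
  qed (rule g)
qed

lemma tall_summable_ideal:
  fixes g :: "nat \<Rightarrow> real"
  assumes g: "\<And>n. 0 \<le> g n" and lim: "\<And>e. e > 0 \<Longrightarrow> finite {n. e \<le> g n}"
  shows "tall {A. g summable_on A}"
  unfolding tall_def
proof (intro allI impI)
  fix X :: "nat set"
  assume X: "infinite X"
  have small: "\<exists>k. k \<in> X \<and> g k \<le> (1/2) ^ i \<and> n < k" for i n :: nat
  proof -
    have "finite ({k. (1/2) ^ i \<le> g k} \<union> {..n})" using lim[of "(1/2) ^ i"] by simp
    then have "infinite (X - ({k. (1/2) ^ i \<le> g k} \<union> {..n}))" using X by (rule Diff_infinite_finite)
    then obtain k where "k \<in> X - ({k. (1/2) ^ i \<le> g k} \<union> {..n})" using infinite_imp_nonempty by blast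
    then show ?thesis by (intro exI[of _ k]) auto
  qed
  have "\<exists>p. \<forall>i. (p i \<in> X \<and> g (p i) \<le> (1/2) ^ i) \<and> p i < p (Suc i)"
    by (rule dependent_nat_choice) (use small in blast)+
  then obtain p where p: "\<And>i. p i \<in> X" "\<And>i. g (p i) \<le> (1/2) ^ i" "\<And>i. p i < p (Suc i)"
    by blast
  have inj: "inj p" by (rule strict_mono_imp_inj_on, rule strict_mono_Suc_iff[THEN iffD2, rule_format], rule p(3))
  have "summable (\<lambda>i. norm ((g \<circ> p) i))"
    by (rule summable_comparison_test'[of "\<lambda>i. (1/2) ^ i" 0]) (use p g in auto)
  then have "g summable_on range p"
    unfolding summable_on_reindex[OF inj] by (rule norm_summable_imp_summable_on)
  moreover have "infinite (range p)" using inj by (rule range_inj_infinite)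
  ultimately show "\<exists>Y\<subseteq>X. infinite Y \<and> Y \<in> {A. g summable_on A}"
    using p(1) by (intro exI[of _ "range p"]) auto
qed

lemma tall_weights_vanish:
  fixes g :: "nat \<Rightarrow> real"
  assumes tall: "tall {A. g summable_on A}" and g: "\<And>n. 0 \<le> g n" and e: "e > 0"
  shows "finite {n. e \<le> g n}"
proof (rule ccontr)
  assume "infinite {n. e \<le> g n}"
  then obtain Y where Y: "Y \<subseteq> {n. e \<le> g n}" "infinite Y" "g summable_on Y"
    using tall unfolding tall_def by blast
  obtain F0 where F0: "finite F0" "\<And>F. finite F \<Longrightarrow> F \<subseteq> Y - F0 \<Longrightarrow> sum g F \<le> e / 2"
    using summable_on_small_tail[OF g Y(3), of "e / 2"] e by (metis half_gt_zero)
  obtain k where "k \<in> Y - F0" using Diff_infinite_finite[OF F0(1) Y(2)] infinite_imp_nonempty by blast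
  then show False using F0(2)[of "{k}"] Y(1) e by auto
qed

section \<open>Ideals and preimages\<close>

lemma ideal_restrict_iff:
  assumes "ideal_on UNIV \<J>" and "B \<subseteq> A"
  shows "B \<in> ideal_restrict \<J> A \<longleftrightarrow> B \<in> \<J>"
proof
  assume "B \<in> ideal_restrict \<J> A"
  then obtain E where "E \<in> \<J>" "B = E \<inter> A" unfolding ideal_restrict_def by blast
  then show "B \<in> \<J>" using assms(1) unfolding ideal_on_def by (metis Int_lower1)
next
  assume "B \<in> \<J>"
  then show "B \<in> ideal_restrict \<J> A" using assms(2) unfolding ideal_restrict_def by blast
qed

lemma ideal_to_one_finite_vimage:
  assumes J: "ideal_on UNIV \<J>" and f: "ideal_to_one \<J> A f" and "finite E"
  shows "f -` E \<inter> A \<in> \<J>"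
  using \<open>finite E\<close>
proof (induction E rule: finite_induct)
  case empty
  then show ?case using J by (simp add: ideal_on_def)
next
  case (insert n E)
  have "f -` insert n E \<inter> A = (f -` {n} \<inter> A) \<union> (f -` E \<inter> A)" by auto
  moreover have "f -` {n} \<inter> A \<in> \<J>" using f by (simp add: ideal_to_one_def)
  ultimately show ?case using J insert.IH by (simp add: ideal_on_def)
qed

section \<open>Meager sets of reals from avoided sequences\<close>

text \<open>
  An enumeration of the rationals, regarded as real numbers.
\<close>
definition nth_rat :: "nat \<Rightarrow> real" where
  "nth_rat a = of_rat (nat_to_rat_surj a)"

text \<open>
  A map from the reals to \<open>\<omega>\<^sup>\<omega>\<close>. Every neighbourhood of the \<open>a\<close>-th rational contains, for each
  \<open>v\<close>, an open interval on which the \<open>a\<close>-th coordinate is constantly \<open>v\<close>: the number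
  \<open>\<lfloor>1 / \<bar>r - q\<bar>\<rfloor>\<close> runs through all large integers as \<open>r\<close> tends to \<open>q\<close>, and the first component of
  the pairing function takes each value infinitely often. At the rational itself the coordinate has
  an irrelevant value, determined by \<open>1 / 0 = 0\<close>.
\<close>
definition real_to_baire :: "real \<Rightarrow> nat \<Rightarrow> nat" where
  "real_to_baire r a = fst (prod_decode (nat \<lfloor>1 / \<bar>r - nth_rat a\<bar>\<rfloor>))"

text \<open>
  This plays the role of the fact that the elements of Baire space which avoid \<open>c\<close> everywhere form
  a closed nowhere dense set, and it spares the transfer of category between the two spaces.
\<close>
lemma nowhere_dense_real_to_baire_neq:
  "nowhere_dense {r. \<forall>a. real_to_baire r a \<noteq> c a}"
proof -
  let ?S = "{r. \<forall>a. real_to_baire r a \<noteq> c a}"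
  have "z \<notin> interior (closure ?S)" for z
  proof
    assume "z \<in> interior (closure ?S)"
    then obtain d where d: "d > 0" "ball z d \<subseteq> interior (closure ?S)"
      using openE[OF open_interior \<open>z \<in> interior (closure ?S)\<close>] by blast
    obtain q where q: "q \<in> \<rat>" "z < q" "q < z + d"
      using Rats_dense_in_real[of z "z + d"] d(1) by auto
    then have "q \<in> ball z d" by (simp add: dist_real_def)
    then have qi: "q \<in> interior (closure ?S)" using d(2) by blast
    obtain a where a: "nth_rat a = q"
      using surj_of_rat_nat_to_rat_surj[OF q(1)] unfolding nth_rat_def by auto
    obtain e where e: "e > 0" "ball q e \<subseteq> closure ?S"
      using qi by (meson mem_interior)
    obtain K :: nat where K: "K > 0" "1 / K < e"
      using nat_approx_posE[OF e(1)] by (metis of_nat_Suc zero_less_Suc)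
    \<comment> \<open>A code \<open>N\<close> of a pair with first component \<open>c a\<close>, large enough that \<open>1 / N < e\<close>.\<close>
    define N where "N = prod_encode (c a, K)"
    have NK: "N \<ge> K" unfolding N_def by (rule le_prod_encode_2)
    then have N0: "N > 0" using K by simp
    define V where "V = {q + 1 / (real N + 1) <..< q + 1 / real N}"
    have "1 / real N \<le> 1 / real K" using NK K by (simp add: frac_le)
    then have lt: "1 / real N < e" using K by linarith
    have pos: "0 < 1 / (real N + 1)" by simp
    have "V \<subseteq> ball q e"
    proof
      fix r assume r: "r \<in> V"
      have "q < r" "r - q < e" using r lt pos unfolding V_def greaterThanLessThan_iff by linarith+
      then show "r \<in> ball q e" by (simp add: dist_real_def)
    qed
    then have sub: "V \<subseteq> closure ?S" using e by blast
    have ne: "V \<noteq> {}"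
      using divide_strict_left_mono[of "real N" "real N + 1" 1] N0 unfolding V_def by simp
    have "r \<notin> ?S" if r: "r \<in> V" for r
    proof -
      have b: "1 / (real N + 1) < r - q" "r - q < 1 / real N"
        using r unfolding V_def greaterThanLessThan_iff by linarith+
      have rq: "r - q > 0" using b pos by linarith
      have "real N < 1 / (r - q)" using b rq N0 by (simp add: field_simps)
      moreover have "1 / (r - q) < real N + 1" using b rq N0 by (simp add: field_simps)
      ultimately have "\<lfloor>1 / (r - q)\<rfloor> = int N" by (simp add: floor_eq_iff)
      then have "real_to_baire r a = c a" using rq a
        by (simp add: real_to_baire_def N_def)
      then show ?thesis by auto
    qed
    then have "V \<inter> ?S = {}" by blast
    then have "V \<inter> closure ?S = {}"
      using open_Int_closure_eq_empty[of V ?S] unfolding V_def by simp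
    then show False using sub ne by blast
  qed
  then show ?thesis unfolding nowhere_dense_def by blast
qed

lemma meager_real_to_baire:
  fixes c :: "nat list \<Rightarrow> nat \<Rightarrow> nat"
  shows "meager {r. \<exists>s. \<forall>a. real_to_baire r a \<noteq> c s a}"
  unfolding meager_def
proof (intro exI conjI allI)
  show "nowhere_dense {r. \<forall>a. real_to_baire r a \<noteq> c (from_nat n) a}" for n
    by (rule nowhere_dense_real_to_baire_neq)
  show "{r. \<exists>s. \<forall>a. real_to_baire r a \<noteq> c s a} =
     (\<Union>n. {r. \<forall>a. real_to_baire r a \<noteq> c (from_nat n) a})"
    by auto (metis from_nat_to_nat)
qed

section \<open>Generic members of a tall summable ideal\<close>

text \<open>
  The \<open>c\<close>-th finite set, provided that its \<open>g\<close>-weight is at most \<open>2\<^sup>-\<^sup>a\<close>; otherwise the empty set.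
\<close>
definition light_set :: "(nat \<Rightarrow> real) \<Rightarrow> nat \<Rightarrow> nat \<Rightarrow> nat set" where
  "light_set g a c = (if sum g (set_decode c) \<le> (1/2) ^ a then set_decode c else {})"

text \<open>
  The union of the finite sets coded by the coordinates of \<open>x\<close>, without those that are too heavy. Its
  total weight is at most \<open>2\<close>, so it belongs to the summable ideal for every \<open>x\<close>.
\<close>
definition generic_set :: "(nat \<Rightarrow> real) \<Rightarrow> (nat \<Rightarrow> nat) \<Rightarrow> nat set" where
  "generic_set g x = (\<Union>a. light_set g a (x a))"

lemma generic_set_summable:
  assumes g: "\<And>n. 0 \<le> g n"
  shows "g summable_on generic_set g x"
  unfolding generic_set_def
  by (rule summable_on_UN_geometric[OF g]) (simp_all add: light_set_def)

lemma generic_set_superset: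
  assumes "finite F" "sum g F \<le> (1/2) ^ a" "x a = set_encode F"
  shows "F \<subseteq> generic_set g x"
proof -
  have "light_set g a (x a) = F" using assms by (simp add: light_set_def set_encode_inverse)
  then show ?thesis unfolding generic_set_def by blast
qed

lemma generic_set_meets:
  assumes lim: "\<And>e. e > 0 \<Longrightarrow> finite {n. e \<le> g n}" and N: "infinite N"
  obtains c :: "nat \<Rightarrow> nat" where "\<And>x a. x a = c a \<Longrightarrow> generic_set g x \<inter> N \<noteq> {}"
proof -
  have "\<exists>n. n \<in> N \<and> g n \<le> (1/2) ^ a" for a :: nat
  proof -
    have "infinite (N - {n. (1/2) ^ a \<le> g n})" by (rule Diff_infinite_finite[OF lim N]) simp
    then obtain n where "n \<in> N - {n. (1/2) ^ a \<le> g n}" using infinite_imp_nonempty by blast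
    then show ?thesis by (intro exI[of _ n]) auto
  qed
  then obtain p where p: "\<And>a. p a \<in> N" "\<And>a. g (p a) \<le> (1/2) ^ a" by metis
  show thesis
  proof (rule that[of "\<lambda>a. set_encode {p a}"])
    fix x :: "nat \<Rightarrow> nat" and a assume "x a = set_encode {p a}"
    then have "{p a} \<subseteq> generic_set g x" by (intro generic_set_superset) (use p in auto)
    then show "generic_set g x \<inter> N \<noteq> {}" using p(1) by blast
  qed
qed

text \<open>
  Countably many genericity requirements suffice to embed a whole run of the game into the generic
  set. Player II answers with the set of all points that are too heavy, so that the next \<open>F\<^sub>n\<close> has
  weight at most \<open>2\<^sup>-\<^sup>a\<close>. A run of this kind is determined by the thresholds \<open>a\<close> used so far, so the
  positions are indexed by lists of naturals. At the position \<open>s\<close> the requirement says that, for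
  some \<open>a\<close>, the coordinate \<open>x a\<close> codes the answer of Player I to the threshold \<open>a\<close>.
\<close>
lemma generic_set_positive:
  assumes J: "ideal_on UNIV \<J>" and g: "\<And>n. 0 \<le> g n"
    and lim: "\<And>e. e > 0 \<Longrightarrow> finite {n. e \<le> g n}"
    and wins: "player_I_wins \<J> A f"
  obtains c :: "nat list \<Rightarrow> nat \<Rightarrow> nat"
    where "\<And>x. (\<And>s. \<exists>a. x a = c s a) \<Longrightarrow> f -` generic_set g x \<inter> A \<notin> \<J>"
proof -
  obtain \<kappa> \<phi> where str: "player_I_winning_strategy \<J> A f \<kappa> \<phi>"
    using wins unfolding player_I_wins_def by blast
  \<comment> \<open>The move of Player II that restricts the answer to weight at most \<open>2\<^sup>-\<^sup>a\<close>.\<close>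
  define heavy where "heavy Gs a = {n. (1/2) ^ a / (real (\<kappa> Gs) + 1) \<le> g n}" for Gs a
  have heavy: "finite (heavy Gs a)" for Gs a unfolding heavy_def by (rule lim) simp
  \<comment> \<open>The moves of Player II along a list of thresholds, the most recent of which comes first.\<close>
  define pos where "pos = rec_list [] (\<lambda>a (_ :: nat list) Gs. Gs @ [heavy Gs a])"
  have pos: "pos [] = []" "pos (a # s) = pos s @ [heavy (pos s) a]" for a s
    by (simp_all add: pos_def)
  define c where "c s a = set_encode (\<phi> (pos (a # s)))" for s a
  show thesis
  proof (rule that[of c])
    fix x :: "nat \<Rightarrow> nat"
    assume x: "\<And>s. \<exists>a. x a = c s a"
    then obtain \<alpha> where \<alpha>: "\<And>s. x (\<alpha> s) = c s (\<alpha> s)" by metis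
    define s where "s = rec_nat [] (\<lambda>_ t. \<alpha> t # t)"
    have s: "s 0 = []" "s (Suc n) = \<alpha> (s n) # s n" for n by (simp_all add: s_def)
    define G where "G n = heavy (pos (s n)) (\<alpha> (s n))" for n
    have hist: "map G [0..<n] = pos (s n)" for n
      by (induction n) (simp_all add: s pos G_def)
    have finG: "\<forall>n. finite (G n)" using heavy by (simp add: G_def)
    define F where "F n = \<phi> (map G [0..<Suc n])" for n
    have F: "finite (F n)" "F n \<inter> G n = {}" "card (F n) \<le> \<kappa> (map G [0..<n])"
      and pF: "f -` (\<Union>n. F n) \<inter> A \<notin> ideal_restrict \<J> A" for n
      using str finG unfolding player_I_winning_strategy_def Let_def F_def by blast+
    have "F n \<subseteq> generic_set g x" for n
    proof (rule generic_set_superset[of _ _ "\<alpha> (s n)"])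
      let ?k = "\<kappa> (pos (s n))" and ?w = "(1/2) ^ \<alpha> (s n) :: real"
      have "g i \<le> ?w / (real ?k + 1)" if "i \<in> F n" for i
      proof -
        have "i \<notin> G n" using F(2) that by blast
        then show ?thesis unfolding G_def heavy_def by simp
      qed
      then have "sum g (F n) \<le> real (card (F n)) * (?w / (real ?k + 1))"
        by (rule sum_bounded_above)
      also have "\<dots> \<le> (real ?k + 1) * (?w / (real ?k + 1))"
        by (rule mult_right_mono) (use F(3)[of n] in \<open>simp_all add: hist\<close>)
      finally show "sum g (F n) \<le> ?w" by simp
      have "F n = \<phi> (pos (\<alpha> (s n) # s n))" unfolding F_def hist s ..
      then show "x (\<alpha> (s n)) = set_encode (F n)" using \<alpha>[of "s n"] by (simp add: c_def)
    qed (rule F(1))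
    then have sub: "f -` (\<Union>n. F n) \<inter> A \<subseteq> f -` generic_set g x \<inter> A" by blast
    have "f -` (\<Union>n. F n) \<inter> A \<notin> \<J>" using pF ideal_restrict_iff[OF J] by simp
    then show "f -` generic_set g x \<inter> A \<notin> \<J>"
      using sub J unfolding ideal_on_def by blast
  qed
qed

section \<open>Covering the reals by meager sets\<close>

lemma card_of_finite_subsets:
  fixes \<A> :: "'a set"
  assumes "infinite \<A>"
  shows "|{F. finite F \<and> F \<subseteq> \<A>}| \<le>o |\<A>|"
proof -
  \<comment> \<open>\<open>K n\<close> contains all subsets of \<open>\<A>\<close> with \<open>n\<close> elements.\<close>
  define K where "K = rec_nat {{}} (\<lambda>_ \<K>. (\<lambda>(a, F). insert a F) ` (\<A> \<times> \<K>))"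
  have K: "K 0 = {{}}" "K (Suc n) = (\<lambda>(a, F). insert a F) ` (\<A> \<times> K n)" for n
    by (simp_all add: K_def)
  have "\<exists>n. F \<in> K n" if "finite F" "F \<subseteq> \<A>" for F
    using that
  proof (induction F rule: finite_induct)
    case empty
    then show ?case using K(1) by blast
  next
    case (insert x F)
    then obtain n where "F \<in> K n" by auto
    then have "insert x F \<in> K (Suc n)" using insert.prems unfolding K(2) by force
    then show ?case by blast
  qed
  then have sub: "{F. finite F \<and> F \<subseteq> \<A>} \<subseteq> (\<Union>n. K n)" by blast
  have le: "|K n| \<le>o |\<A>|" for n
  proof (induction n)
    case 0
    have "|{{}}| \<le>o |\<A>|"
      by (rule card_of_singl_ordLeq) (use assms in auto)
    then show ?case by (simp add: K(1))
  next
    case (Suc n)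
    have "|K (Suc n)| \<le>o |\<A> \<times> K n|" unfolding K(2) by (rule card_of_image)
    also have "|\<A> \<times> K n| \<le>o |\<A> \<times> \<A>|" by (rule card_of_Times_mono2[OF Suc.IH])
    also have "|\<A> \<times> \<A>| =o |\<A>|" by (rule card_of_Times_same_infinite[OF assms])
    finally show ?case .
  qed
  have "|\<Union>n. K n| \<le>o |\<A>|"
    by (rule card_of_UNION_ordLeq_infinite[OF assms])
      (use le assms infinite_iff_card_of_nat in auto)
  then show ?thesis by (rule ordLeq_transitive[OF card_of_mono1[OF sub]])
qed

text \<open>
  The family \<open>\<A>\<close> is replaced by a family \<open>\<D>\<close> of the same size at most, closed under binary
  intersections, such that it suffices to make \<open>f -` B\<close> positive on each member of \<open>\<D>\<close>. Let \<open>N D\<close> be the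
  set of those \<open>n\<close> whose fibre is positive on \<open>D\<close>. If \<open>N D\<close> is empty, then \<open>f\<close> is \<open>\<J>\<close>-to-one on \<open>D\<close>, and
  the game makes the preimage of the generic set positive on \<open>D\<close>; if \<open>N D\<close> is infinite, the generic
  set meets \<open>N D\<close>. If \<open>N D0\<close> is finite for some \<open>D0 \<in> \<D>\<close>, then \<open>N D0\<close> is added to the generic set, and each
  \<open>D\<close> may be replaced by \<open>D \<inter> D0\<close>, for which \<open>N (D \<inter> D0)\<close> is empty or meets \<open>N D0\<close>. If the reals not generic for some \<open>D\<close> failed to cover the
  line, then a real outside all of these meager sets would produce a set \<open>B\<close> contradicting \<open>bad\<close>.
\<close>
theorem cov_meager_le_card_bad_family:
  fixes \<I> \<J> :: "nat set set"
  assumes I: "ideal_on UNIV \<I>" and J: "ideal_on UNIV \<J>"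
    and ex: "\<exists>\<S>. summable_ideal \<S> \<and> tall \<S> \<and> \<S> \<subseteq> \<I>"
    and wins: "\<And>A. A \<notin> \<J> \<Longrightarrow> ideal_to_one \<J> A f \<Longrightarrow> player_I_wins \<J> A f"
    and fip: "has_FIP \<J> \<A>"
    and bad: "\<And>B. B \<in> \<I> \<Longrightarrow> \<not> has_FIP \<J> (\<A> \<union> {f -` B})"
  shows "cov_meager \<le>o |\<A>|"
proof -
  obtain g :: "nat \<Rightarrow> real" where g: "\<And>n. 0 \<le> g n" and tall: "tall {A. g summable_on A}"
    and gI: "\<And>A. g summable_on A \<Longrightarrow> A \<in> \<I>"
    using ex unfolding summable_ideal_def by blast
  have lim: "finite {n. e \<le> g n}" if "e > 0" for e by (rule tall_weights_vanish[OF tall g that])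
  have up: "Y \<notin> \<J>" if "X \<notin> \<J>" "X \<subseteq> Y" for X Y using J that unfolding ideal_on_def by blast
  \<comment> \<open>A finite \<open>\<A>\<close> has to be treated apart, since it may have more finite subsets than elements.\<close>
  define \<D> where "\<D> = (if finite \<A> then {\<Inter>\<A>} else Inter ` {F. finite F \<and> F \<subseteq> \<A>})"
  have D_sub: "\<exists>F. finite F \<and> F \<subseteq> \<A> \<and> D = \<Inter>F" if "D \<in> \<D>" for D
    using that unfolding \<D>_def by (auto split: if_splits)
  have D_pos: "D \<notin> \<J>" if "D \<in> \<D>" for D
    using D_sub[OF that] fip unfolding has_FIP_def by blast
  have D_Int: "D \<inter> D' \<in> \<D>" if D: "D \<in> \<D>" and D': "D' \<in> \<D>" for D D'
  proof (cases "finite \<A>")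
    case True
    then show ?thesis using D D' unfolding \<D>_def by simp
  next
    case False
    obtain F F' where F: "finite F" "F \<subseteq> \<A>" "D = \<Inter>F" "finite F'" "F' \<subseteq> \<A>" "D' = \<Inter>F'"
      using D_sub[OF D] D_sub[OF D'] by blast
    then have "D \<inter> D' = \<Inter>(F \<union> F')" by (simp add: Inter_Un_distrib)
    moreover have "F \<union> F' \<in> {F. finite F \<and> F \<subseteq> \<A>}" using F by simp
    ultimately show ?thesis using False unfolding \<D>_def by simp
  qed
  have D_below: "\<exists>D\<in>\<D>. D \<subseteq> \<Inter>F" if "finite F" "F \<subseteq> \<A>" for F
  proof (cases "finite \<A>")
    case True
    then show ?thesis using that unfolding \<D>_def by (simp add: Inter_anti_mono)
  next
    case False
    then show ?thesis using that unfolding \<D>_def by auto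
  qed
  have D_card: "|\<D>| \<le>o |\<A>|"
  proof (cases "finite \<A>")
    case True
    have "|{\<Inter>\<A>}| \<le>o |\<A>|"
      by (rule card_of_singl_ordLeq) (use fip in \<open>simp add: has_FIP_def\<close>)
    then show ?thesis using True by (simp add: \<D>_def)
  next
    case False
    then have "|\<D>| \<le>o |{F. finite F \<and> F \<subseteq> \<A>}|" unfolding \<D>_def by (simp add: card_of_image)
    then show ?thesis by (rule ordLeq_transitive) (rule card_of_finite_subsets[OF False])
  qed
  define N where "N D = {n. f -` {n} \<inter> D \<notin> \<J>}" for D
  have N_mono: "N D \<subseteq> N D'" if "D \<subseteq> D'" for D D' using that up unfolding N_def by blast
  have one: "ideal_to_one \<J> D f \<longleftrightarrow> N D = {}" for D by (auto simp: ideal_to_one_def N_def)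
  have "\<exists>c :: nat list \<Rightarrow> nat \<Rightarrow> nat. \<forall>x. (\<forall>s. \<exists>a. x a = c s a) \<longrightarrow>
      (N D = {} \<longrightarrow> f -` generic_set g x \<inter> D \<notin> \<J>) \<and> (infinite (N D) \<longrightarrow> generic_set g x \<inter> N D \<noteq> {})"
    if D: "D \<in> \<D>" for D
  proof (cases "N D = {}")
    case True
    then have "player_I_wins \<J> D f" using wins D_pos[OF D] one by blast
    from generic_set_positive[OF J g lim this] True show ?thesis by (metis finite.emptyI)
  next
    case False
    show ?thesis
    proof (cases "finite (N D)")
      case inf: False
      obtain c :: "nat \<Rightarrow> nat" where c: "\<And>x a. x a = c a \<Longrightarrow> generic_set g x \<inter> N D \<noteq> {}"
        using generic_set_meets[OF lim inf] by blast
      show ?thesis using False c by (intro exI[of _ "\<lambda>_. c"]) blast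
    qed (use False in blast)
  qed
  then obtain c :: "nat set \<Rightarrow> nat list \<Rightarrow> nat \<Rightarrow> nat" where
    c: "\<And>D x. D \<in> \<D> \<Longrightarrow> \<forall>s. \<exists>a. x a = c D s a \<Longrightarrow>
      (N D = {} \<longrightarrow> f -` generic_set g x \<inter> D \<notin> \<J>) \<and> (infinite (N D) \<longrightarrow> generic_set g x \<inter> N D \<noteq> {})"
    by metis
  define \<C> where "\<C> = (\<lambda>D. {r. \<exists>s. \<forall>a. real_to_baire r a \<noteq> c D s a}) ` \<D>"
  have "r \<in> \<Union>\<C>" for r
  proof (rule ccontr)
    assume "r \<notin> \<Union>\<C>"
    then have hit: "\<forall>s. \<exists>a. real_to_baire r a = c D s a" if "D \<in> \<D>" for D
      using that unfolding \<C>_def by blast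
    define X where "X = generic_set g (real_to_baire r)"
    have X1: "f -` X \<inter> D \<notin> \<J>" if "D \<in> \<D>" "N D = {}" for D
      using c[OF that(1) hit[OF that(1)]] that(2) unfolding X_def by blast
    have X2: "X \<inter> N D \<noteq> {}" if "D \<in> \<D>" "infinite (N D)" for D
      using c[OF that(1) hit[OF that(1)]] that(2) unfolding X_def by blast
    have "\<exists>E. finite E \<and> (\<forall>D\<in>\<D>. f -` (X \<union> E) \<inter> D \<notin> \<J>)"
    proof (cases "\<exists>D0\<in>\<D>. finite (N D0)")
      case True
      then obtain D0 where D0: "D0 \<in> \<D>" "finite (N D0)" by blast
      have "f -` (X \<union> N D0) \<inter> D \<notin> \<J>" if D: "D \<in> \<D>" for D
      proof (cases "N (D \<inter> D0) = {}")
        case True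
        have "f -` X \<inter> (D \<inter> D0) \<notin> \<J>" by (rule X1[OF D_Int[OF D D0(1)] True])
        then show ?thesis by (rule up) blast
      next
        case False
        then obtain n where n: "n \<in> N (D \<inter> D0)" by blast
        then have "n \<in> N D0" using N_mono[of "D \<inter> D0" D0] by blast
        have "f -` {n} \<inter> (D \<inter> D0) \<notin> \<J>" using n by (simp add: N_def)
        then show ?thesis by (rule up) (use \<open>n \<in> N D0\<close> in blast)
      qed
      then show ?thesis using D0(2) by blast
    next
      case False
      have "f -` (X \<union> {}) \<inter> D \<notin> \<J>" if D: "D \<in> \<D>" for D
      proof -
        obtain n where n: "n \<in> X" "f -` {n} \<inter> D \<notin> \<J>" using X2[OF D] False D unfolding N_def by blast
        from n(2) show ?thesis by (rule up) (use n(1) in blast)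
      qed
      then show ?thesis by blast
    qed
    then obtain E where E: "finite E" "\<And>D. D \<in> \<D> \<Longrightarrow> f -` (X \<union> E) \<inter> D \<notin> \<J>" by blast
    have "X \<in> \<I>" unfolding X_def by (rule gI[OF generic_set_summable[OF g]])
    then have "X \<union> E \<in> \<I>" using I E(1) unfolding ideal_on_def by simp
    moreover have "has_FIP \<J> (\<A> \<union> {f -` (X \<union> E)})"
      unfolding has_FIP_def
    proof (intro conjI allI impI)
      fix F assume F: "finite F \<and> F \<subseteq> \<A> \<union> {f -` (X \<union> E)}"
      obtain D where D: "D \<in> \<D>" "D \<subseteq> \<Inter>(F \<inter> \<A>)" using D_below[of "F \<inter> \<A>"] F by auto
      have "f -` (X \<union> E) \<inter> D \<subseteq> \<Inter>F" using D(2) F by blast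
      then show "\<Inter>F \<notin> \<J>" by (rule up[OF E(2)[OF D(1)]])
    qed simp
    ultimately show False using bad by blast
  qed
  then have "\<Union>\<C> = UNIV" by blast
  moreover have "\<forall>M\<in>\<C>. meager M" unfolding \<C>_def using meager_real_to_baire by blast
  ultimately have "cov_meager \<le>o |\<C>|" using cov_meager_minimum by blast
  also have "|\<C>| \<le>o |\<D>|" unfolding \<C>_def by (rule card_of_image)
  also note D_card
  finally show ?thesis .
qed

lemma cov_meager_le_continuum: "cov_meager \<le>o |UNIV :: nat set set|"
proof -
  have "meager {x}" for x :: real
    unfolding meager_def nowhere_dense_def by (intro exI[of _ "\<lambda>_. {x}"]) auto
  then have "cov_meager \<le>o |range (\<lambda>x :: real. {x})|"
    using cov_meager_minimum by auto
  also have "|range (\<lambda>x :: real. {x})| \<le>o |UNIV :: real set|" by (rule card_of_image)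
  also have "|UNIV :: real set| \<le>o |UNIV :: nat set set|"
  proof -
    have "inj (\<lambda>x :: real. {a. nth_rat a < x})"
    proof (rule injI)
      have *: "\<not> x < y" if "{a. nth_rat a < x} = {a. nth_rat a < y}" for x y :: real
      proof
        assume "x < y"
        then obtain q where q: "q \<in> \<rat>" "x < q" "q < y" using Rats_dense_in_real by blast
        obtain a where "nth_rat a = q"
          using surj_of_rat_nat_to_rat_surj[OF q(1)] unfolding nth_rat_def by auto
        then have "a \<in> {a. nth_rat a < y}" "a \<notin> {a. nth_rat a < x}" using q by auto
        then show False using that by blast
      qed
      fix x y :: real assume "{a. nth_rat a < x} = {a. nth_rat a < y}"
      then show "x = y" using *[of x y] *[of y x] by auto
    qed
    then show ?thesis by (intro card_of_ordLeqI) auto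
  qed
  finally show ?thesis .
qed

lemma cov_meager_le_fip:
  fixes \<I> \<J> :: "nat set set"
  assumes I: "ideal_on UNIV \<I>" and J: "ideal_on UNIV \<J>"
    and ex: "\<exists>\<S>. summable_ideal \<S> \<and> tall \<S> \<and> \<S> \<subseteq> \<I>"
    and wins: "\<And>A f. A \<notin> \<J> \<Longrightarrow> ideal_to_one \<J> A f \<Longrightarrow> player_I_wins \<J> A f"
  shows "cov_meager \<le>o fip \<I> \<J> UNIV"
proof -
  have "fip \<I> \<J> UNIV =o cardSuc |UNIV :: nat set set| \<or>
     (\<exists>\<A>. (has_FIP \<J> \<A> \<and> \<not> (\<forall>f\<in>UNIV. \<exists>B\<in>\<I>. has_FIP \<J> (\<A> \<union> {f -` B}))) \<and> fip \<I> \<J> UNIV =o |\<A>| )"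
    using fip_minimum[of \<I> \<J> UNIV] by simp
  then show ?thesis
  proof
    assume *: "fip \<I> \<J> UNIV =o cardSuc |UNIV :: nat set set|"
    have "|UNIV :: nat set set| \<le>o cardSuc |UNIV :: nat set set|"
      by (rule cardSuc_ordLeq[OF card_of_Card_order])
    from ordLeq_transitive[OF cov_meager_le_continuum this] show ?thesis
      by (rule ordLeq_ordIso_trans) (rule ordIso_symmetric[OF *])
  next
    assume "\<exists>\<A>. (has_FIP \<J> \<A> \<and> \<not> (\<forall>f\<in>UNIV. \<exists>B\<in>\<I>. has_FIP \<J> (\<A> \<union> {f -` B}))) \<and> fip \<I> \<J> UNIV =o |\<A>|"
    then obtain \<A> f where \<A>: "has_FIP \<J> \<A>" "\<And>B. B \<in> \<I> \<Longrightarrow> \<not> has_FIP \<J> (\<A> \<union> {f -` B})"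
      and eq: "fip \<I> \<J> UNIV =o |\<A>|" by blast
    have "cov_meager \<le>o |\<A>|"
      by (rule cov_meager_le_card_bad_family[OF I J ex wins \<A>])
    then show ?thesis by (rule ordLeq_ordIso_trans) (rule ordIso_symmetric[OF eq])
  qed
qed

section \<open>Borel sets are analytic\<close>

text \<open>
  Analytic subsets of the Cantor space, as projections of closed subsets of its product with
  Baire space.
\<close>
definition analytic_set :: "(nat \<Rightarrow> bool) set \<Rightarrow> bool" where
  "analytic_set S \<longleftrightarrow> (\<exists>C :: ((nat \<Rightarrow> bool) \<times> (nat \<Rightarrow> nat)) set. closed C \<and> S = fst ` C)"

lemma continuous_on_reindex_pair:
  fixes h :: "nat \<Rightarrow> nat"
  shows "continuous_on UNIV (\<lambda>p :: (nat \<Rightarrow> bool) \<times> (nat \<Rightarrow> nat). (fst p, \<lambda>i. snd p (h i)))"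
proof -
  have "continuous_on UNIV (\<lambda>p :: (nat \<Rightarrow> bool) \<times> (nat \<Rightarrow> nat). snd p (h i))" for i
    by (rule continuous_on_product_then_coordinatewise[OF continuous_on_snd[OF continuous_on_id]])
  then show ?thesis
    by (intro continuous_on_Pair continuous_on_fst continuous_on_id continuous_on_coordinatewise_then_product)
qed

lemma closed_imp_analytic:
  assumes "closed S" shows "analytic_set S"
  unfolding analytic_set_def
proof (intro exI conjI)
  show "closed (S \<times> (UNIV :: (nat \<Rightarrow> nat) set))" using assms by (intro closed_Times) auto
  show "S = fst ` (S \<times> (UNIV :: (nat \<Rightarrow> nat) set))" by simp
qed

text \<open>
  A witness for the union starts with the index of one of the sets.
\<close>
lemma analytic_UN:
  fixes S :: "nat \<Rightarrow> (nat \<Rightarrow> bool) set"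
  assumes "\<And>n. analytic_set (S n)"
  shows "analytic_set (\<Union>n. S n)"
proof -
  obtain C :: "nat \<Rightarrow> ((nat \<Rightarrow> bool) \<times> (nat \<Rightarrow> nat)) set"
    where C: "\<And>n. closed (C n)" "\<And>n. S n = fst ` C n"
    using assms unfolding analytic_set_def by metis
  define sh :: "(nat \<Rightarrow> bool) \<times> (nat \<Rightarrow> nat) \<Rightarrow> (nat \<Rightarrow> bool) \<times> (nat \<Rightarrow> nat)"
    where "sh = (\<lambda>p. (fst p, \<lambda>i. snd p (Suc i)))"
  have sh: "continuous_on UNIV sh" unfolding sh_def by (rule continuous_on_reindex_pair)
  define hd0 :: "(nat \<Rightarrow> bool) \<times> (nat \<Rightarrow> nat) \<Rightarrow> nat" where "hd0 = (\<lambda>p. snd p 0)"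
  have hd0: "continuous_on UNIV hd0" unfolding hd0_def
    by (rule continuous_on_product_then_coordinatewise[OF continuous_on_snd[OF continuous_on_id]])
  define D where "D = (\<Inter>n. hd0 -` (- {n}) \<union> sh -` C n)"
  have "closed (hd0 -` (- {n}))" for n
    by (rule closed_vimage[OF _ hd0]) (simp add: closed_def open_discrete)
  moreover have "closed (sh -` C n)" for n by (rule closed_vimage[OF C(1) sh])
  ultimately have "closed D" unfolding D_def by (intro closed_INT ballI closed_Un)
  moreover have "(\<Union>n. S n) = fst ` D"
  proof (intro equalityI subsetI)
    fix x assume "x \<in> (\<Union>n. S n)"
    then obtain n y where "(x, y) \<in> C n" using C(2) by force
    then have "(x, case_nat n y) \<in> D" by (auto simp: D_def sh_def hd0_def)
    then show "x \<in> fst ` D" by force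
  next
    fix x assume "x \<in> fst ` D"
    then obtain y where "(x, y) \<in> D" by auto
    then have "sh (x, y) \<in> C (y 0)" by (auto simp: D_def hd0_def)
    then have "x \<in> fst ` C (y 0)" by (force simp: sh_def)
    then show "x \<in> (\<Union>n. S n)" using C(2) by blast
  qed
  ultimately show ?thesis unfolding analytic_set_def by blast
qed

text \<open>
  A witness for the intersection codes one witness for each of the sets.
\<close>
lemma analytic_INT:
  fixes S :: "nat \<Rightarrow> (nat \<Rightarrow> bool) set"
  assumes "\<And>n. analytic_set (S n)"
  shows "analytic_set (\<Inter>n. S n)"
proof -
  obtain C :: "nat \<Rightarrow> ((nat \<Rightarrow> bool) \<times> (nat \<Rightarrow> nat)) set"
    where C: "\<And>n. closed (C n)" "\<And>n. S n = fst ` C n"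
    using assms unfolding analytic_set_def by metis
  define pr :: "nat \<Rightarrow> (nat \<Rightarrow> bool) \<times> (nat \<Rightarrow> nat) \<Rightarrow> (nat \<Rightarrow> bool) \<times> (nat \<Rightarrow> nat)"
    where "pr = (\<lambda>n p. (fst p, \<lambda>i. snd p (prod_encode (n, i))))"
  have pr: "continuous_on UNIV (pr n)" for n
    unfolding pr_def by (rule continuous_on_reindex_pair)
  define D where "D = (\<Inter>n. pr n -` C n)"
  have "closed D" unfolding D_def by (intro closed_INT ballI closed_vimage C(1) pr)
  moreover have "(\<Inter>n. S n) = fst ` D"
  proof (intro equalityI subsetI)
    fix x assume "x \<in> (\<Inter>n. S n)"
    then have "\<forall>n. \<exists>y. (x, y) \<in> C n" using C(2) by force
    then obtain y where y: "\<And>n. (x, y n) \<in> C n" by metis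
    have "(x, \<lambda>k. case prod_decode k of (n, i) \<Rightarrow> y n i) \<in> D"
      using y by (simp add: D_def pr_def)
    then show "x \<in> fst ` D" by force
  next
    fix x assume "x \<in> fst ` D"
    then obtain y where y: "(x, y) \<in> D" by auto
    have "x \<in> S n" for n
    proof -
      have "pr n (x, y) \<in> C n" using y unfolding D_def by blast
      then show ?thesis unfolding C(2) by (force simp: pr_def)
    qed
    then show "x \<in> (\<Inter>n. S n)" by blast
  qed
  ultimately show ?thesis unfolding analytic_set_def by blast
qed

lemma open_fun_agree:
  fixes u :: "nat \<Rightarrow> 'b::topological_space"
  assumes U: "open U" "u \<in> U"
  obtains l where "\<And>z. \<forall>i<l. z i = u i \<Longrightarrow> z \<in> U"
proof -
  obtain X where X: "u \<in> Pi\<^sub>E UNIV X" "finite {i. X i \<noteq> UNIV}" "Pi\<^sub>E UNIV X \<subseteq> U"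
    using product_topology_open_contains_basis[of "\<lambda>i. euclidean" UNIV U u] U
    unfolding open_fun_def by auto
  obtain l where l: "{i. X i \<noteq> UNIV} \<subseteq> {..<l}"
    using X(2) by (meson finite_nat_iff_bounded)
  have "z \<in> U" if z: "\<forall>i<l. z i = u i" for z
  proof -
    have "z i \<in> X i" for i
    proof (cases "X i = UNIV")
      case False
      then have "i < l" using l by auto
      then show ?thesis using z X(1) by (auto simp: PiE_iff)
    qed simp
    then show ?thesis using X(3) by (auto simp: PiE_iff)
  qed
  then show thesis by (rule that)
qed

lemma open_imp_analytic:
  fixes U :: "(nat \<Rightarrow> bool) set"
  assumes "open U"
  shows "analytic_set U"
proof -
  \<comment> \<open>The basic clopen set of all sequences extending \<open>bs\<close>.\<close>
  define cyl :: "bool list \<Rightarrow> (nat \<Rightarrow> bool) set"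
    where "cyl bs = (\<Inter>i\<in>{..<length bs}. (\<lambda>x. x i) -` {bs ! i})" for bs
  have cyl: "closed (cyl bs)" for bs
    unfolding cyl_def
    by (intro closed_INT ballI closed_vimage continuous_on_product_coordinates) simp
  define P where "P n = (if cyl (from_nat n) \<subseteq> U then cyl (from_nat n) else {})" for n
  have "analytic_set (\<Union>n. P n)"
    by (intro analytic_UN closed_imp_analytic) (simp add: P_def cyl)
  moreover have "(\<Union>n. P n) = U"
  proof (intro equalityI subsetI)
    fix u assume "u \<in> U"
    then obtain l where l: "\<And>z. \<forall>i<l. z i = u i \<Longrightarrow> z \<in> U"
      using open_fun_agree[OF assms] by metis
    let ?bs = "map u [0..<l]"
    have "cyl ?bs \<subseteq> U" using l by (auto simp: cyl_def)
    then have "P (to_nat ?bs) = cyl ?bs" by (simp add: P_def)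
    moreover have "u \<in> cyl ?bs" by (simp add: cyl_def)
    ultimately show "u \<in> (\<Union>n. P n)" by blast
  qed (auto simp: P_def split: if_splits)
  ultimately show ?thesis by simp
qed

lemma borel_imp_analytic:
  fixes S :: "(nat \<Rightarrow> bool) set"
  assumes "S \<in> sets borel"
  shows "analytic_set S"
proof -
  have "S \<in> sigma_sets UNIV {U. open U}"
    using assms unfolding borel_def by simp
  then have "analytic_set S \<and> analytic_set (- S)"
  proof (induction rule: sigma_sets.induct)
    case (Basic U)
    then show ?case using open_imp_analytic closed_imp_analytic by (simp add: closed_def)
  next
    case Empty
    then show ?case by (simp add: closed_imp_analytic)
  next
    case (Compl k)
    then show ?case by (simp add: Compl_eq_Diff_UNIV[symmetric])
  next
    case (Union k)
    have "- (\<Union>n. k n) = (\<Inter>n. - k n)" by blast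
    then show ?case using analytic_UN[of k] analytic_INT[of "\<lambda>n. - k n"] Union.IH by simp
  qed
  then show ?thesis ..
qed

lemma mem_closed_if_agree:
  fixes C :: "((nat \<Rightarrow> bool) \<times> (nat \<Rightarrow> nat)) set"
  assumes "closed C"
    and agree: "\<And>l. \<exists>z w. (z, w) \<in> C \<and> (\<forall>i<l. z i = x i \<and> w i = y i)"
  shows "(x, y) \<in> C"
proof (rule ccontr)
  assume "(x, y) \<notin> C"
  have "open (- C)" using assms(1) by (simp add: closed_def)
  with \<open>(x, y) \<notin> C\<close> obtain U V where UV: "open U" "open V" "x \<in> U" "y \<in> V" "U \<times> V \<subseteq> - C"
    by (metis ComplI mem_Sigma_iff open_prod_elim)
  obtain l1 where l1: "\<And>z. \<forall>i<l1. z i = x i \<Longrightarrow> z \<in> U" using open_fun_agree[OF UV(1,3)] by blast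
  obtain l2 where l2: "\<And>w. \<forall>i<l2. w i = y i \<Longrightarrow> w \<in> V" using open_fun_agree[OF UV(2,4)] by blast
  obtain z w where zw: "(z, w) \<in> C" "\<forall>i<max l1 l2. z i = x i \<and> w i = y i" using agree by blast
  then have "z \<in> U" "w \<in> V" using l1 l2 by auto
  then show False using zw(1) UV(5) by blast
qed

lemma analytic_positive_sets:
  assumes "borel_family \<J>"
  shows "analytic_set {z. f -` {n. z n} \<inter> A \<notin> \<J>}"
proof (rule borel_imp_analytic)
  define \<phi> :: "(nat \<Rightarrow> bool) \<Rightarrow> nat \<Rightarrow> bool" where "\<phi> z = (\<lambda>k. k \<in> A \<and> z (f k))" for z
  have "continuous_on UNIV \<phi>"
    unfolding \<phi>_def
  proof (rule continuous_on_coordinatewise_then_product)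
    fix k
    show "continuous_on UNIV (\<lambda>z :: nat \<Rightarrow> bool. k \<in> A \<and> z (f k))"
      by (cases "k \<in> A") auto
  qed
  then have "\<phi> \<in> borel_measurable borel" by (rule borel_measurable_continuous_onI)
  then have "\<phi> -` {x. {n. x n} \<in> \<J>} \<inter> space borel \<in> sets borel"
    using assms unfolding borel_family_def by (rule measurable_sets)
  then have "- (\<phi> -` {x. {n. x n} \<in> \<J>}) \<in> sets borel" by simp
  moreover have "{k. \<phi> z k} = f -` {n. z n} \<inter> A" for z by (auto simp: \<phi>_def)
  ultimately show "{z. f -` {n. z n} \<inter> A \<notin> \<J>} \<in> sets borel"
    by (simp add: vimage_def Collect_neg_eq)
qed

section \<open>Determinacy of games with infinitely many marked moves\<close>

text \<open>
  Winning strategies of Player I for the reachability game towards the next marked move. A node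
  carries a reply, and a tree for the rest of the game, for each move of Player II; a leaf is reached when a
  marked move has just been made. Being well-founded, a tree forces a marked move after finitely many
  rounds.
\<close>
datatype 'x attractor_tree = Leaf | Node (reply: "nat \<Rightarrow> 'x") (subtree: "nat \<Rightarrow> 'x attractor_tree")

text \<open>
  For a node, the tree is a correct strategy from the history \<open>h\<close>: its replies are legal, and it stops
  only after a marked move, at a history in \<open>X\<close>. For a leaf, \<open>h\<close> itself lies in \<open>X\<close>.
\<close>
primrec forces :: "('x list \<Rightarrow> nat \<Rightarrow> 'x \<Rightarrow> bool) \<Rightarrow> ('x \<Rightarrow> bool) \<Rightarrow> 'x list set
    \<Rightarrow> 'x attractor_tree \<Rightarrow> 'x list \<Rightarrow> bool" where
  "forces legal mark X Leaf h \<longleftrightarrow> h \<in> X"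
| "forces legal mark X (Node a t) h \<longleftrightarrow>
     (\<forall>m. legal h m (a m) \<and> forces legal mark X (t m) (h @ [a m]) \<and> (t m = Leaf \<longrightarrow> mark (a m)))"

text \<open>
  The function \<open>\<sigma>\<close> is a winning strategy of Player II from the history \<open>h\<close>: in every legal play that extends
  \<open>h\<close> and in which Player II moves according to \<open>\<sigma>\<close>, Player I makes only finitely many marked moves.
\<close>
definition co_buchi_wins :: "('x list \<Rightarrow> nat \<Rightarrow> 'x \<Rightarrow> bool) \<Rightarrow> ('x \<Rightarrow> bool) \<Rightarrow> 'x list
    \<Rightarrow> ('x list \<Rightarrow> nat) \<Rightarrow> bool" where
  "co_buchi_wins legal mark h \<sigma> \<longleftrightarrow>
     (\<forall>x. map x [0..<length h] = h \<longrightarrow>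
        (\<forall>i\<ge>length h. legal (map x [0..<i]) (\<sigma> (map x [0..<i])) (x i)) \<longrightarrow> finite {i. mark (x i)})"

text \<open>
  If Player I could not force a marked move that leaves Player II without a winning strategy, then
  Player II would keep the play outside the set \<open>A\<close> of histories from which this can be forced, and would change
  to a winning strategy after the first marked move; this would be a winning strategy.
\<close>
lemma co_buchi_extend:
  assumes "\<nexists>\<sigma>. co_buchi_wins legal mark h \<sigma>"
  shows "\<exists>t. t \<noteq> Leaf \<and> forces legal mark {h. \<nexists>\<sigma>. co_buchi_wins legal mark h \<sigma>} t h"
proof (rule ccontr)
  assume neg: "\<not> ?thesis"
  define X where "X = {h. \<nexists>\<sigma>. co_buchi_wins legal mark h \<sigma>}"
  define A where "A = {h. \<exists>t. t \<noteq> Leaf \<and> forces legal mark X t h}"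
  have "h \<notin> A" using neg by (simp add: A_def X_def)
  have esc: "\<exists>m. \<forall>x. legal h' m x \<longrightarrow> h' @ [x] \<notin> A \<and> (mark x \<longrightarrow> h' @ [x] \<notin> X)" if "h' \<notin> A" for h'
  proof (rule ccontr)
    assume none: "\<not> ?thesis"
    have "\<exists>x t. legal h' m x \<and> forces legal mark X t (h' @ [x]) \<and> (t = Leaf \<longrightarrow> mark x)" for m
    proof -
      obtain x where x: "legal h' m x" "h' @ [x] \<in> A \<or> mark x \<and> h' @ [x] \<in> X"
        using none by blast
      from x(2) show ?thesis
      proof
        assume "h' @ [x] \<in> A"
        then show ?thesis using x(1) unfolding A_def by blast
      next
        assume "mark x \<and> h' @ [x] \<in> X"
        then show ?thesis using x(1) by (intro exI[of _ x] exI[of _ Leaf]) simp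
      qed
    qed
    then obtain a t where "\<And>m. legal h' m (a m) \<and> forces legal mark X (t m) (h' @ [a m]) \<and> (t m = Leaf \<longrightarrow> mark (a m))"
      by metis
    then have "forces legal mark X (Node a t) h'" by simp
    then show False using that unfolding A_def by blast
  qed
  then obtain \<kappa> where \<kappa>: "\<And>h' x. h' \<notin> A \<Longrightarrow> legal h' (\<kappa> h') x \<Longrightarrow> h' @ [x] \<notin> A"
      "\<And>h' x. h' \<notin> A \<Longrightarrow> legal h' (\<kappa> h') x \<Longrightarrow> mark x \<Longrightarrow> h' @ [x] \<notin> X"
    by metis
  define S where "S h' = (SOME \<sigma>. co_buchi_wins legal mark h' \<sigma>)" for h'
  have S: "co_buchi_wins legal mark h' (S h')" if "h' \<notin> X" for h'
  proof -
    obtain \<sigma> where "co_buchi_wins legal mark h' \<sigma>" using \<open>h' \<notin> X\<close> by (auto simp: X_def)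
    then show ?thesis unfolding S_def by (rule someI[of "co_buchi_wins legal mark h'"])
  qed
  let ?l = "length h"
  \<comment> \<open>\<open>P h' j\<close>: the \<open>j\<close>-th move of \<open>h'\<close> is marked and was made after \<open>h\<close>.\<close>
  define P where "P h' j \<longleftrightarrow> ?l \<le> j \<and> j < length h' \<and> mark (h' ! j)" for h' j
  define \<sigma> where "\<sigma> h' = (if \<exists>j. P h' j then S (take (Suc (LEAST j. P h' j)) h') h' else \<kappa> h')" for h'
  have "co_buchi_wins legal mark h \<sigma>"
    unfolding co_buchi_wins_def
  proof (intro allI impI)
    fix x
    assume xh: "map x [0..<?l] = h"
      and leg: "\<forall>i\<ge>?l. legal (map x [0..<i]) (\<sigma> (map x [0..<i])) (x i)"
    show "finite {i. mark (x i)}"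
    proof (cases "\<exists>j\<ge>?l. mark (x j)")
      case False
      then have "{i. mark (x i)} \<subseteq> {..<?l}" by (auto simp: not_le[symmetric])
      then show ?thesis using finite_subset by blast
    next
      case True
      define j where "j = (LEAST j. j \<ge> ?l \<and> mark (x j))"
      have j: "j \<ge> ?l" "mark (x j)" using LeastI_ex[OF True[unfolded Bex_def]] unfolding j_def by auto
      have jmin: "j \<le> i" if "i \<ge> ?l" "mark (x i)" for i
        unfolding j_def using that by (auto intro: Least_le)
      have early: "\<sigma> (map x [0..<i]) = \<kappa> (map x [0..<i])" if "i \<le> j" for i
        using jmin that unfolding \<sigma>_def P_def by force
      have late: "\<sigma> (map x [0..<i]) = S (map x [0..<Suc j]) (map x [0..<i])" if "i \<ge> Suc j" for i
      proof -
        have "P (map x [0..<i]) j" using j that by (simp add: P_def)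
        moreover have "(LEAST j'. P (map x [0..<i]) j') = j"
          by (rule Least_equality) (use j that jmin in \<open>auto simp: P_def\<close>)
        moreover have "take (Suc j) (map x [0..<i]) = map x [0..<Suc j]"
          using that by (simp add: take_map take_upt del: upt_Suc)
        ultimately show ?thesis unfolding \<sigma>_def by auto
      qed
      have notA: "?l \<le> i \<Longrightarrow> i \<le> j \<Longrightarrow> map x [0..<i] \<notin> A" for i
      proof (induction i rule: dec_induct)
        case base
        then show ?case using \<open>h \<notin> A\<close> xh by simp
      next
        case (step i)
        then have "map x [0..<i] \<notin> A" by simp
        moreover have "legal (map x [0..<i]) (\<kappa> (map x [0..<i])) (x i)"
          using leg early[of i] step by auto
        ultimately show ?case using \<kappa>(1)[of "map x [0..<i]" "x i"] by simp
      qed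
      have "legal (map x [0..<j]) (\<kappa> (map x [0..<j])) (x j)" using leg early j by force
      from \<kappa>(2)[OF notA[OF j(1) order_refl] this j(2)]
      have "map x [0..<Suc j] \<notin> X" by simp
      then have "co_buchi_wins legal mark (map x [0..<Suc j]) (S (map x [0..<Suc j]))" by (rule S)
      moreover have "\<forall>i\<ge>Suc j. legal (map x [0..<i]) (S (map x [0..<Suc j]) (map x [0..<i])) (x i)"
        using leg late j(1) by (metis Suc_leD le_trans)
      ultimately show ?thesis unfolding co_buchi_wins_def by (simp del: upt_Suc)
    qed
  qed
  then show False using assms by blast
qed

text \<open>
  Determinacy of infinite games in which Player I wants to make infinitely many marked moves, over an arbitrary
  set of moves \<open>'x\<close> of Player I. In each round Player II plays a number \<open>m\<close>, and Player I replies by a legal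
  move. If Player II has no winning strategy, then Player I has one; it is given as a function \<open>\<tau>\<close> of the list of
  the moves of Player II.
\<close>
theorem buchi_determinacy:
  fixes legal :: "'x list \<Rightarrow> nat \<Rightarrow> 'x \<Rightarrow> bool" and mark :: "'x \<Rightarrow> bool"
  assumes "\<nexists>\<sigma>. \<forall>x. (\<forall>i. legal (map x [0..<i]) (\<sigma> (map x [0..<i])) (x i)) \<longrightarrow> finite {i. mark (x i)}"
  obtains \<tau> :: "nat list \<Rightarrow> 'x" where
    "\<And>m i. legal (map (\<lambda>j. \<tau> (map m [0..<Suc j])) [0..<i]) (m i) (\<tau> (map m [0..<Suc i]))"
    "\<And>m. infinite {i. mark (\<tau> (map m [0..<Suc i]))}"
proof -
  define X where "X = {h. \<nexists>\<sigma>. co_buchi_wins legal mark h \<sigma>}"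
  have nil: "[] \<in> X" using assms by (simp add: X_def co_buchi_wins_def)
  define T where "T h = (SOME t. t \<noteq> Leaf \<and> forces legal mark X t h)" for h
  have T: "T h \<noteq> Leaf \<and> forces legal mark X (T h) h" if "h \<in> X" for h
    unfolding T_def by (rule someI_ex) (use that co_buchi_extend[of legal mark h] in \<open>simp add: X_def\<close>)
  \<comment> \<open>The state consists of the history and the current tree; at a leaf, the next tree is taken.\<close>
  define step where "step = (\<lambda>(h, t) m.
    let h' = h @ [reply t m] in (h', if subtree t m = Leaf then T h' else subtree t m))"
  define st where "st ms = foldl step ([], T []) ms" for ms
  define \<tau> where "\<tau> ms = reply (snd (st (butlast ms))) (last ms)" for ms
  have inv: "snd (st ms) \<noteq> Leaf \<and> forces legal mark X (snd (st ms)) (fst (st ms))" for ms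
  proof (induction ms rule: rev_induct)
    case Nil
    then show ?case using T[OF nil] by (simp add: st_def)
  next
    case (snoc m ms)
    obtain h a t where ht: "st ms = (h, Node a t)"
      using snoc by (metis attractor_tree.exhaust prod.collapse)
    have e: "st (ms @ [m]) = (h @ [a m], if t m = Leaf then T (h @ [a m]) else t m)"
      using ht by (simp add: st_def step_def Let_def)
    have f: "forces legal mark X (t m) (h @ [a m])" using snoc ht by simp
    then show ?case using e T[of "h @ [a m]"] by auto
  qed
  have stS: "st (map m [0..<Suc i]) =
      (fst (st (map m [0..<i])) @ [\<tau> (map m [0..<Suc i])],
       if subtree (snd (st (map m [0..<i]))) (m i) = Leaf
       then T (fst (st (map m [0..<i])) @ [\<tau> (map m [0..<Suc i])])
       else subtree (snd (st (map m [0..<i]))) (m i))" for m i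
    by (simp add: st_def step_def \<tau>_def split: prod.split) (simp add: Let_def case_prod_beta)
  have hist: "fst (st (map m [0..<i])) = map (\<lambda>j. \<tau> (map m [0..<Suc j])) [0..<i]" for m i
  proof (induction i)
    case 0
    then show ?case by (simp add: st_def)
  next
    case (Suc i)
    then show ?case unfolding stS by simp
  qed
  have node: "\<exists>a t. snd (st (map m [0..<i])) = Node a t \<and> \<tau> (map m [0..<Suc i]) = a (m i)" for m i
    using inv[of "map m [0..<i]"] by (cases "snd (st (map m [0..<i]))") (auto simp: \<tau>_def)
  show thesis
  proof
    fix m i
    show "legal (map (\<lambda>j. \<tau> (map m [0..<Suc j])) [0..<i]) (m i) (\<tau> (map m [0..<Suc i]))"
      using node[of m i] inv[of "map m [0..<i]"] hist[of m i] by (metis forces.simps(2))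
  next
    fix m
    have "\<exists>j\<ge>i. mark (\<tau> (map m [0..<Suc j]))" if "snd (st (map m [0..<i])) = t" for t i
      using that
    proof (induction t arbitrary: i)
      case Leaf
      then show ?case using inv by metis
    next
      case (Node a t)
      have \<tau>: "\<tau> (map m [0..<Suc i]) = a (m i)" using node[of m i] Node.prems by auto
      show ?case
      proof (cases "t (m i) = Leaf")
        case True
        then have "mark (a (m i))" using inv[of "map m [0..<i]"] Node.prems by auto
        then show ?thesis using \<tau> by (metis order_refl)
      next
        case False
        then have "snd (st (map m [0..<Suc i])) = t (m i)" unfolding stS using Node.prems by simp
        from Node.IH[OF rangeI this] show ?thesis by (meson Suc_leD)
      qed
    qed
    then show "infinite {i. mark (\<tau> (map m [0..<Suc i]))}"
      by (simp add: infinite_nat_iff_unbounded_le)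
  qed
qed

section \<open>The unfolded game\<close>

text \<open>
  In the unfolded game, Player I accompanies the finite set \<open>F\<^sub>n\<close> by an optional number. The numbers
  announced so far form an initial segment of the point of Baire space that is to witness, through a
  closed set \<open>C\<close>, that the union of the sets \<open>F\<^sub>n\<close> is positive. The following two functions extract from a
  history the union of the finite sets and the list of the announced numbers.
\<close>
definition played :: "(nat set \<times> nat option) list \<Rightarrow> nat set" where
  "played h = \<Union> (fst ` set h)"

definition witness :: "(nat set \<times> nat option) list \<Rightarrow> nat list" where
  "witness h = map (\<lambda>x. the (snd x)) (filter (\<lambda>x. snd x \<noteq> None) h)"

text \<open>
  Some point of \<open>C\<close> agrees with the characteristic function of \<open>E\<close> and with \<open>ys\<close> below the length of \<open>ys\<close>.
\<close>
definition consistent :: "((nat \<Rightarrow> bool) \<times> (nat \<Rightarrow> nat)) set \<Rightarrow> nat set \<Rightarrow> nat list \<Rightarrow> bool" where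
  "consistent C E ys \<longleftrightarrow>
     (\<exists>z w. (z, w) \<in> C \<and> (\<forall>i<length ys. z i = (i \<in> E) \<and> w i = ys ! i))"

text \<open>
  Player II plays \<open>m\<close>, which stands for the finite set \<open>{..<m}\<close>. In round \<open>n\<close>, Player I replies by at
  most \<open>n\<close> points, all of them at least \<open>n\<close>, so that membership below \<open>n\<close> is settled after finitely many
  rounds. After each announcement the position must be consistent with \<open>C\<close>. An announced number must be at
  most \<open>n\<close>, so that for a given sequence of finite sets there are only
  finitely many possible histories of each length; in exchange, Player I may postpone the announcement. Player
  I wins by making infinitely many announcements.
\<close>
definition unfolded_legal :: "((nat \<Rightarrow> bool) \<times> (nat \<Rightarrow> nat)) set \<Rightarrow>
    (nat set \<times> nat option) list \<Rightarrow> nat \<Rightarrow> nat set \<times> nat option \<Rightarrow> bool" where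
  "unfolded_legal C h m x \<longleftrightarrow>
     finite (fst x) \<and> card (fst x) \<le> length h \<and> (\<forall>e\<in>fst x. m \<le> e \<and> length h \<le> e) \<and>
     (\<forall>c. snd x = Some c \<longrightarrow> c \<le> length h \<and> consistent C (played (h @ [x])) (witness (h @ [x])))"

lemma witness_append [simp]: "witness (h @ h') = witness h @ witness h'"
  by (simp add: witness_def)

lemma witness_single: "witness [x] = (case snd x of None \<Rightarrow> [] | Some c \<Rightarrow> [c])"
  by (simp add: witness_def split: option.split)

lemma played_map_upt: "played (map x [0..<n]) = (\<Union>i<n. fst (x i))"
  by (auto simp: played_def)

lemma length_witness_le: "length (witness h) \<le> length h"
  by (simp add: witness_def)

lemma unfolded_run_in_projection:
  fixes x :: "nat \<Rightarrow> nat set \<times> nat option"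
  assumes C: "closed C"
    and leg: "\<And>i. unfolded_legal C (map x [0..<i]) (m i) (x i)"
    and inf: "infinite {i. snd (x i) \<noteq> None}"
  shows "(\<lambda>n. n \<in> (\<Union>i. fst (x i))) \<in> fst ` C"
proof -
  define Y where "Y n = witness (map x [0..<n])" for n
  have YS: "Y (Suc n) = Y n @ (case snd (x n) of None \<Rightarrow> [] | Some c \<Rightarrow> [c])" for n
    unfolding Y_def by (simp add: witness_single)
  have Yle: "length (Y n) \<le> n" for n
    unfolding Y_def using length_witness_le[of "map x [0..<n]"] by simp
  have mono: "length (Y n) \<le> length (Y n') \<and> (\<forall>i<length (Y n). Y n' ! i = Y n ! i)" if "n \<le> n'" for n n'
    using that
  proof (induction n' rule: dec_induct)
    case (step k)
    then show ?case unfolding YS by (auto simp: nth_append)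
  qed simp
  have unb: "\<exists>n. l < length (Y n)" for l
  proof (induction l)
    case 0
    obtain i where "snd (x i) \<noteq> None" using inf not_finite_existsD by blast
    then have "length (Y (Suc i)) > 0" unfolding YS by auto
    then show ?case by blast
  next
    case (Suc l)
    then obtain n where n: "l < length (Y n)" by blast
    obtain i where i: "i \<ge> n" "snd (x i) \<noteq> None"
      using inf unfolding infinite_nat_iff_unbounded_le by blast
    have "length (Y (Suc i)) = Suc (length (Y i))" using i(2) unfolding YS by auto
    then have "Suc l < length (Y (Suc i))" using mono[OF i(1)] n by linarith
    then show ?case by blast
  qed
  \<comment> \<open>The announced numbers, independently of the round in which they are read off.\<close>
  define y where "y l = Y (LEAST n. l < length (Y n)) ! l" for l
  have y: "Y n ! l = y l" if "l < length (Y n)" for n l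
  proof -
    have "(LEAST n. l < length (Y n)) \<le> n" by (rule Least_le) (rule that)
    moreover have "l < length (Y (LEAST n. l < length (Y n)))" by (rule LeastI) (rule that)
    ultimately show ?thesis unfolding y_def using mono by blast
  qed
  have "(\<lambda>n. n \<in> (\<Union>i. fst (x i)), y) \<in> C"
  proof (rule mem_closed_if_agree[OF C])
    fix l
    \<comment> \<open>Round \<open>N - 1\<close> is the one in which the \<open>l\<close>-th value is announced.\<close>
    define N where "N = (LEAST n. l < length (Y n))"
    have N: "l < length (Y N)" unfolding N_def by (rule LeastI_ex[OF unb])
    then obtain k where k: "N = Suc k" using Yle[of N] by (cases N) auto
    have "\<not> l < length (Y k)" using not_less_Least[of k "\<lambda>n. l < length (Y n)"] k N_def by auto
    then obtain c where c: "snd (x k) = Some c"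
      using N unfolding k YS by (cases "snd (x k)") auto
    have "consistent C (played (map x [0..<N])) (Y N)"
      using leg[of k] c unfolding unfolded_legal_def k Y_def by simp
    then obtain z w where zw: "(z, w) \<in> C"
        "\<And>i. i < length (Y N) \<Longrightarrow> z i = (i \<in> (\<Union>j<N. fst (x j))) \<and> w i = Y N ! i"
      unfolding consistent_def played_map_upt by blast
    have "z i = (i \<in> (\<Union>j. fst (x j))) \<and> w i = y i" if i: "i < l" for i
    proof -
      have iN: "i < length (Y N)" "i < N" using i N Yle[of N] by linarith+
      have "i \<in> (\<Union>j<N. fst (x j))" if "i \<in> fst (x j)" for j
      proof -
        have "j \<le> i" using leg[of j] that unfolding unfolded_legal_def by auto
        then show ?thesis using iN(2) that by auto
      qed
      then show ?thesis using zw(2)[OF iN(1)] y[OF iN(1)] by auto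
    qed
    then show "\<exists>z w. (z, w) \<in> C \<and> (\<forall>i<l. z i = (i \<in> (\<Union>j. fst (x j))) \<and> w i = y i)"
      using zw(1) by blast
  qed
  then show ?thesis by (rule rev_image_eqI) simp
qed

text \<open>
  Since only finitely many histories of length at most \<open>j\<close> use points below \<open>M j\<close> and numbers up to \<open>j\<close>, the
  sequence \<open>M\<close> can be chosen to outgrow the answers of the strategy to them.
\<close>
lemma unfolded_strategy_bounds:
  fixes \<sigma> :: "(nat set \<times> nat option) list \<Rightarrow> nat"
  obtains M :: "nat \<Rightarrow> nat" where "M 0 = 0" "\<And>j. M j + Suc j \<le> M (Suc j)"
    "\<And>h j. length h \<le> j \<Longrightarrow> (\<And>F o'. (F, o') \<in> set h \<Longrightarrow> F \<subseteq> {..<M j} \<and> (\<forall>c. o' = Some c \<longrightarrow> c \<le> j))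
       \<Longrightarrow> \<sigma> h \<le> M (Suc j)"
proof -
  \<comment> \<open>The histories of length at most \<open>j\<close> with points below \<open>K\<close> and numbers up to \<open>j\<close>.\<close>
  define H where "H j K = {h. set h \<subseteq> Pow {..<K} \<times> insert None (Some ` {..j}) \<and> length h \<le> j}" for j K :: nat
  have fin: "finite (H j K)" for j K
    unfolding H_def by (rule finite_lists_length_le) simp
  define M where "M = rec_nat 0 (\<lambda>j K. K + Suc j + sum \<sigma> (H j K))"
  have M: "M 0 = 0" "M (Suc j) = M j + Suc j + sum \<sigma> (H j (M j))" for j
    by (simp_all add: M_def)
  show thesis
  proof (rule that[of M])
    fix h j
    assume "length h \<le> j"
      and *: "\<And>F o'. (F, o') \<in> set h \<Longrightarrow> F \<subseteq> {..<M j} \<and> (\<forall>c. o' = Some c \<longrightarrow> c \<le> j)"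
    have "p \<in> Pow {..<M j} \<times> insert None (Some ` {..j})" if "p \<in> set h" for p
      using *[of "fst p" "snd p"] that by (cases p; cases "snd p") auto
    then have "h \<in> H j (M j)" unfolding H_def using \<open>length h \<le> j\<close> by blast
    then have "\<sigma> h \<le> sum \<sigma> (H j (M j))" by (intro member_le_sum fin) auto
    then show "\<sigma> h \<le> M (Suc j)" unfolding M by simp
  qed (simp_all add: M)
qed

text \<open>
  Against a winning strategy of Player II, Player I may play, one after the other, the parts of \<open>B\<close> in every second
  interval, and announce the next value of an alleged witness \<open>y\<close> as soon as the number of the round permits it. All
  moves are legal, and every value is eventually announced, so there is no such witness.
\<close>
lemma thin_not_in_projection:
  fixes \<sigma> :: "(nat set \<times> nat option) list \<Rightarrow> nat"
  assumes win: "\<And>x. (\<And>i. unfolded_legal C (map x [0..<i]) (\<sigma> (map x [0..<i])) (x i)) \<Longrightarrow>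
      finite {i. snd (x i) \<noteq> None}"
    and M: "\<And>j. M j + Suc j \<le> M (Suc j)"
    and \<sigma>M: "\<And>h j. length h \<le> j \<Longrightarrow> (\<And>F o'. (F, o') \<in> set h \<Longrightarrow> F \<subseteq> {..<M j} \<and> (\<forall>c. o' = Some c \<longrightarrow> c \<le> j))
       \<Longrightarrow> \<sigma> h \<le> M (Suc j)"
    and d: "d > 0"
    and thin: "\<And>i. card (B \<inter> {M (2 * i + d)..<M (Suc (2 * i + d))}) \<le> i"
  shows "(\<lambda>n. n \<in> (\<Union>i. B \<inter> {M (2 * i + d)..<M (Suc (2 * i + d))})) \<notin> fst ` C"
proof
  define F where "F i = B \<inter> {M (2 * i + d)..<M (Suc (2 * i + d))}" for i
  assume "(\<lambda>n. n \<in> (\<Union>i. B \<inter> {M (2 * i + d)..<M (Suc (2 * i + d))})) \<in> fst ` C"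
  then obtain y where y: "(\<lambda>n. n \<in> (\<Union>i. F i), y) \<in> C" unfolding F_def by force
  have "M j < M (Suc j)" for j using M[of j] by linarith
  then have sm: "strict_mono M" by (rule strict_mono_Suc_iff[THEN iffD2, rule_format])
  have Mge: "j \<le> M j" for j using sm by (rule strict_mono_imp_increasing)
  \<comment> \<open>\<open>L i\<close> is the number of values announced before round \<open>i\<close>.\<close>
  define L where "L = rec_nat 0 (\<lambda>i l. if y l \<le> i then Suc l else l)"
  have L: "L 0 = 0" "L (Suc i) = (if y (L i) \<le> i then Suc (L i) else L i)" for i
    by (simp_all add: L_def)
  have Lle: "L i \<le> i" for i by (induction i) (auto simp: L)
  define x where "x i = (F i, if y (L i) \<le> i then Some (y (L i)) else None)" for i
  have wit: "witness (map x [0..<n]) = map y [0..<L n]" for n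
  proof (induction n)
    case 0
    then show ?case by (simp add: L witness_def)
  next
    case (Suc n)
    then show ?case by (simp add: witness_single x_def L)
  qed
  have "unfolded_legal C (map x [0..<i]) (\<sigma> (map x [0..<i])) (x i)" for i
  proof -
    have "\<sigma> (map x [0..<i]) \<le> M (Suc (2 * i + d - 1))"
    proof (rule \<sigma>M)
      show "length (map x [0..<i]) \<le> 2 * i + d - 1" using d by simp
      fix E o' assume "(E, o') \<in> set (map x [0..<i])"
      then obtain j where j: "j < i" "E = F j" "o' = (if y (L j) \<le> j then Some (y (L j)) else None)"
        unfolding x_def by auto
      have "M (Suc (2 * j + d)) \<le> M (2 * i + d - 1)"
        using strict_mono_less_eq[OF sm] j(1) by simp
      then show "E \<subseteq> {..<M (2 * i + d - 1)} \<and> (\<forall>c. o' = Some c \<longrightarrow> c \<le> 2 * i + d - 1)"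
        using j unfolding F_def by auto
    qed
    then have s: "\<sigma> (map x [0..<i]) \<le> M (2 * i + d)" using d by simp
    have ge: "M (2 * i + d) \<le> e" if "e \<in> F i" for e i using that by (simp add: F_def)
    have ge': "i \<le> e" if "e \<in> F i" for e i
      using ge[OF that] Mge[of "2 * i + d"] by linarith
    have "consistent C (played (map x [0..<i] @ [x i])) (witness (map x [0..<i] @ [x i]))"
    proof -
      have "i' \<in> (\<Union>j<Suc i. F j) \<longleftrightarrow> i' \<in> (\<Union>j. F j)" if "i' < L (Suc i)" for i'
      proof -
        have "i' < Suc i" using that Lle[of "Suc i"] by linarith
        then have "j < Suc i" if "i' \<in> F j" for j using ge'[OF that] by linarith
        then show ?thesis by blast
      qed
      moreover have "played (map x [0..<Suc i]) = (\<Union>j<Suc i. F j)"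
        unfolding played_map_upt by (simp add: x_def)
      ultimately have "consistent C (played (map x [0..<Suc i])) (map y [0..<L (Suc i)])"
        unfolding consistent_def using y by (intro exI[of _ "\<lambda>n. n \<in> (\<Union>i. F i)"] exI[of _ y]) auto
      then show ?thesis using wit[of "Suc i"] by simp
    qed
    then show ?thesis
      unfolding unfolded_legal_def using thin[of i] s ge[of _ i] ge'[of _ i]
      by (auto simp: x_def F_def split: if_splits)
  qed
  then have "finite {i. snd (x i) \<noteq> None}" by (rule win)
  then obtain k where k: "{i. snd (x i) \<noteq> None} \<subseteq> {..<k}"
    unfolding finite_nat_iff_bounded by blast
  have stop: "\<not> y (L i) \<le> i" if "i \<ge> k" for i
  proof
    assume "y (L i) \<le> i"
    then have "i \<in> {i. snd (x i) \<noteq> None}" by (simp add: x_def)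
    then have "i < k" using k by blast
    then show False using that by simp
  qed
  have const: "L i = L k" if "i \<ge> k" for i
    using that
  proof (induction i rule: dec_induct)
    case (step i)
    then show ?case using stop[of i] by (simp add: L)
  qed simp
  define i where "i = max k (y (L k))"
  have "k \<le> i" "y (L k) \<le> i" by (simp_all add: i_def)
  then show False using stop[of i] const[of i] by simp
qed

section \<open>From a strategy of Player II to a summable ideal\<close>

text \<open>
  The weight of a point of the \<open>j\<close>-th interval is \<open>1 / (j + 1)\<close>. A set of finite total weight has
  weight at most \<open>1 / 4\<close> outside a finite set, and hence at most \<open>(j + 1) / 4\<close> points in the \<open>j\<close>-th interval.
\<close>
lemma thin_intervals_summable_ideal:
  fixes M :: "nat \<Rightarrow> nat"
  assumes M0: "M 0 = 0" and M: "\<And>j. M j + Suc j \<le> M (Suc j)"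
  obtains \<S> where "summable_ideal \<S>" "tall \<S>"
    "\<And>B. B \<in> \<S> \<Longrightarrow> \<exists>F0. finite F0 \<and> (\<forall>j. 4 * card ((B - F0) \<inter> {M j..<M (Suc j)}) \<le> Suc j)"
proof -
  have "M j < M (Suc j)" for j using M[of j] by linarith
  then have sm: "strict_mono M" by (rule strict_mono_Suc_iff[THEN iffD2, rule_format])
  have Mge: "j \<le> M j" for j using sm by (rule strict_mono_imp_increasing)
  \<comment> \<open>The index of the interval that contains \<open>n\<close>.\<close>
  define blk where "blk n = (LEAST j. n < M (Suc j))" for n
  have blk: "blk n = j" if n: "n \<in> {M j..<M (Suc j)}" for n j
    unfolding blk_def
  proof (rule Least_equality)
    show "n < M (Suc j)" using n by simp
    fix i assume "n < M (Suc i)"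
    then have "M j < M (Suc i)" using n by auto
    then show "j \<le> i" using strict_mono_less[OF sm] by auto
  qed
  define g :: "nat \<Rightarrow> real" where "g n = 1 / (real (blk n) + 1)" for n
  have g0: "0 \<le> g n" for n by (simp add: g_def)
  have gsum: "sum g F = real (card F) / (real j + 1)" if "F \<subseteq> {M j..<M (Suc j)}" for F j
  proof -
    have "sum g F = (\<Sum>n\<in>F. 1 / (real j + 1))"
      by (rule sum.cong) (use that blk in \<open>auto simp: g_def subset_iff\<close>)
    then show ?thesis by simp
  qed
  have thin: "\<exists>F0. finite F0 \<and> (\<forall>j. 4 * card ((B - F0) \<inter> {M j..<M (Suc j)}) \<le> Suc j)"
    if smB: "g summable_on B" for B
  proof -
    obtain F0 where F0: "finite F0" "\<And>F. finite F \<Longrightarrow> F \<subseteq> B - F0 \<Longrightarrow> sum g F \<le> 1 / 4"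
      using summable_on_small_tail[OF g0 smB, of "1 / 4"] by (metis zero_less_divide_1_iff zero_less_numeral)
    have "4 * card ((B - F0) \<inter> {M j..<M (Suc j)}) \<le> Suc j" for j
    proof -
      let ?F = "(B - F0) \<inter> {M j..<M (Suc j)}"
      have "real (card ?F) / (real j + 1) \<le> 1 / 4"
        using F0(2)[of ?F] gsum[of ?F j] by auto
      then have "4 * real (card ?F) \<le> real j + 1" by (simp add: field_simps)
      then show ?thesis by linarith
    qed
    then show ?thesis using F0(1) by blast
  qed
  have "\<not> g summable_on UNIV"
  proof
    assume "g summable_on UNIV"
    then obtain F0 where F0: "finite F0"
        "\<And>j. 4 * card ((UNIV - F0) \<inter> {M j..<M (Suc j)}) \<le> Suc j"
      using thin by blast
    obtain j where j: "F0 \<subseteq> {..<j}" using F0(1) by (meson finite_nat_iff_bounded)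
    have "(UNIV - F0) \<inter> {M j..<M (Suc j)} = {M j..<M (Suc j)}"
      using j Mge[of j] by auto
    then have "4 * (M (Suc j) - M j) \<le> Suc j" using F0(2)[of j] by simp
    then show False using M[of j] by linarith
  qed
  then have "summable_ideal {A. g summable_on A}"
    unfolding summable_ideal_def using g0 by blast
  moreover have "tall {A. g summable_on A}"
  proof (rule tall_summable_ideal[OF g0])
    fix e :: real assume e: "e > 0"
    obtain J :: nat where J: "1 / e < real J" using reals_Archimedean2 by blast
    have "n < M J" if "e \<le> g n" for n
    proof (rule ccontr)
      assume "\<not> n < M J"
      have "n < M (Suc n)" using Mge[of "Suc n"] by linarith
      then have "n < M (Suc (blk n))" unfolding blk_def by (rule LeastI)
      with \<open>\<not> n < M J\<close> have "M J < M (Suc (blk n))" by linarith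
      then have "J \<le> blk n" using strict_mono_less[OF sm] by auto
      then have "1 / e < real (blk n) + 1" using J by linarith
      then have "g n < e" using e by (simp add: g_def field_simps)
      then show False using that by simp
    qed
    then have "{n. e \<le> g n} \<subseteq> {..<M J}" by auto
    then show "finite {n. e \<le> g n}" by (rule finite_subset) simp
  qed
  ultimately show thesis using that thin by blast
qed

text \<open>
  For a member \<open>B\<close> of the summable ideal, all but a finite part of \<open>B\<close> is covered by its thin parts in the
  odd intervals, and in the even intervals from the second on; the preimages of both parts are in \<open>\<J>\<close>.
\<close>
lemma player_II_katetov:
  assumes J: "ideal_on UNIV \<J>" and f: "ideal_to_one \<J> A f"
    and C: "{z. f -` {n. z n} \<inter> A \<notin> \<J>} = fst ` C"
    and win: "\<And>x. (\<And>i. unfolded_legal C (map x [0..<i]) (\<sigma> (map x [0..<i])) (x i)) \<Longrightarrow>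
      finite {i. snd (x i) \<noteq> None}"
  shows "\<exists>\<S>. summable_ideal \<S> \<and> tall \<S> \<and> katetov_above A (ideal_restrict \<J> A) \<S>"
proof -
  obtain M where M: "M 0 = 0" "\<And>j. M j + Suc j \<le> M (Suc j)"
    "\<And>h j. length h \<le> j \<Longrightarrow> (\<And>F o'. (F, o') \<in> set h \<Longrightarrow> F \<subseteq> {..<M j} \<and> (\<forall>c. o' = Some c \<longrightarrow> c \<le> j))
       \<Longrightarrow> \<sigma> h \<le> M (Suc j)"
    by (rule unfolded_strategy_bounds[of \<sigma>]) blast
  obtain \<S> where \<S>: "summable_ideal \<S>" "tall \<S>"
    "\<And>B. B \<in> \<S> \<Longrightarrow> \<exists>F0. finite F0 \<and> (\<forall>j. 4 * card ((B - F0) \<inter> {M j..<M (Suc j)}) \<le> Suc j)"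
    by (rule thin_intervals_summable_ideal[OF M(1,2)]) blast
  have un: "X \<union> Y \<in> \<J>" if "X \<in> \<J>" "Y \<in> \<J>" for X Y using J that by (simp add: ideal_on_def)
  have "f -` B \<inter> A \<in> \<J>" if B: "B \<in> \<S>" for B
  proof -
    obtain F0 where F0: "finite F0" "\<And>j. 4 * card ((B - F0) \<inter> {M j..<M (Suc j)}) \<le> Suc j"
      using \<S>(3)[OF B] by blast
    define P where "P d = (\<Union>i. (B - F0) \<inter> {M (2 * i + d)..<M (Suc (2 * i + d))})" for d
    have P: "f -` P d \<inter> A \<in> \<J>" if d: "d = 1 \<or> d = 2" for d
    proof -
      have thin: "card ((B - F0) \<inter> {M (2 * i + d)..<M (Suc (2 * i + d))}) \<le> i" for i
        using F0(2)[of "2 * i + d"] d by linarith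
      have "d > 0" using d by auto
      have "(\<lambda>n. n \<in> P d) \<notin> fst ` C"
        unfolding P_def by (rule thin_not_in_projection[OF win M(2,3) \<open>d > 0\<close> thin])
      then have "(\<lambda>n. n \<in> P d) \<notin> {z. f -` {n. z n} \<inter> A \<notin> \<J>}" using C by simp
      then show ?thesis by (simp only: mem_Collect_eq Collect_mem_eq not_not)
    qed
    have "B \<subseteq> (F0 \<union> {..<M 1}) \<union> (P 1 \<union> P 2)"
    proof
      fix n assume n: "n \<in> B"
      define j where "j = (LEAST j. n < M (Suc j))"
      have "M j < M (Suc j)" for j using M(2)[of j] by linarith
      then have sm: "strict_mono M" by (rule strict_mono_Suc_iff[THEN iffD2, rule_format])
      have "n < M (Suc n)" using strict_mono_imp_increasing[OF sm, of "Suc n"] by linarith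
      then have up: "n < M (Suc j)" unfolding j_def by (rule LeastI)
      have low: "M j \<le> n"
      proof (cases j)
        case (Suc k)
        then show ?thesis using not_less_Least[of k "\<lambda>j. n < M (Suc j)"] unfolding j_def by auto
      qed (simp add: M(1))
      have "j = 0 \<or> (\<exists>i. j = 2 * i + 1) \<or> (\<exists>i. j = 2 * i + 2)" by presburger
      then consider "j = 0" | i where "j = 2 * i + 1" | i where "j = 2 * i + 2" by blast
      then show "n \<in> (F0 \<union> {..<M 1}) \<union> (P 1 \<union> P 2)"
      proof cases
        case 1
        then show ?thesis using up by simp
      next
        case (2 i)
        then show ?thesis using up low n unfolding P_def by (cases "n \<in> F0") (auto intro!: exI[of _ i])
      next
        case (3 i)
        then show ?thesis using up low n unfolding P_def by (cases "n \<in> F0") (auto intro!: exI[of _ i])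
      qed
    qed
    then have sub: "f -` B \<inter> A \<subseteq> (f -` (F0 \<union> {..<M 1}) \<inter> A) \<union> ((f -` P 1 \<inter> A) \<union> (f -` P 2 \<inter> A))" by blast
    have "(f -` (F0 \<union> {..<M 1}) \<inter> A) \<union> ((f -` P 1 \<inter> A) \<union> (f -` P 2 \<inter> A)) \<in> \<J>"
      by (intro un P ideal_to_one_finite_vimage[OF J f]) (use F0(1) in simp_all)
    then show ?thesis using J sub unfolding ideal_on_def by blast
  qed
  then have "katetov_above A (ideal_restrict \<J> A) \<S>"
    unfolding katetov_above_def using ideal_restrict_iff[OF J] by (metis Int_lower2)
  then show ?thesis using \<S>(1,2) by blast
qed

text \<open>
  Determinacy of the unfolded game replaces determinacy of the original, Borel game. A winning strategy of Player
  I for the unfolded game, with the announcements ignored, wins the original one with \<open>k\<^sub>n = n\<close>.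
\<close>
theorem borel_player_I_wins:
  assumes J: "ideal_on UNIV \<J>" and bor: "borel_family \<J>" and f: "ideal_to_one \<J> A f"
    and no: "\<not> (\<exists>\<S>. summable_ideal \<S> \<and> tall \<S> \<and> katetov_above A (ideal_restrict \<J> A) \<S>)"
  shows "player_I_wins \<J> A f"
proof -
  obtain C :: "((nat \<Rightarrow> bool) \<times> (nat \<Rightarrow> nat)) set"
    where C: "closed C" "{z. f -` {n. z n} \<inter> A \<notin> \<J>} = fst ` C"
    using analytic_positive_sets[OF bor, of f A] unfolding analytic_set_def by blast
  let ?mark = "\<lambda>x :: nat set \<times> nat option. snd x \<noteq> None"
  have "\<nexists>\<sigma>. \<forall>x. (\<forall>i. unfolded_legal C (map x [0..<i]) (\<sigma> (map x [0..<i])) (x i)) \<longrightarrow> finite {i. ?mark (x i)}"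
    using player_II_katetov[OF J f C(2)] no by blast
  then obtain \<tau> :: "nat list \<Rightarrow> nat set \<times> nat option" where
    \<tau>: "\<And>m i. unfolded_legal C (map (\<lambda>j. \<tau> (map m [0..<Suc j])) [0..<i]) (m i) (\<tau> (map m [0..<Suc i]))"
      "\<And>m. infinite {i. ?mark (\<tau> (map m [0..<Suc i]))}"
    by (rule buchi_determinacy[of "unfolded_legal C" ?mark]) blast
  \<comment> \<open>The least bound of a finite set, by which Player II's move is translated to the unfolded game.\<close>
  define bnd :: "nat set \<Rightarrow> nat" where "bnd G = (LEAST m. G \<subseteq> {..<m})" for G
  have bnd: "G \<subseteq> {..<bnd G}" if "finite G" for G
    unfolding bnd_def by (rule LeastI_ex) (use that in \<open>simp add: finite_nat_iff_bounded\<close>)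
  have "player_I_winning_strategy \<J> A f length (\<lambda>Gs. fst (\<tau> (map bnd Gs)))"
    unfolding player_I_winning_strategy_def Let_def
  proof (intro allI impI)
    fix G :: "nat \<Rightarrow> nat set"
    assume G: "\<forall>n. finite (G n)"
    define m where "m i = bnd (G i)" for i
    define x where "x i = \<tau> (map m [0..<Suc i])" for i
    have leg: "unfolded_legal C (map x [0..<i]) (m i) (x i)" for i
      using \<tau>(1)[of m i] unfolding x_def .
    have inf: "infinite {i. snd (x i) \<noteq> None}" using \<tau>(2)[of m] unfolding x_def .
    have F: "fst (\<tau> (map bnd (map G [0..<Suc n]))) = fst (x n)" for n
    proof -
      have "m = (\<lambda>i. bnd (G i))" by (simp add: m_def fun_eq_iff)
      then show ?thesis by (simp add: x_def comp_def)
    qed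
    have "(\<lambda>n. n \<in> (\<Union>i. fst (x i))) \<in> {z. f -` {n. z n} \<inter> A \<notin> \<J>}"
      unfolding C(2) by (rule unfolded_run_in_projection[OF C(1) leg inf])
    then have "f -` (\<Union>i. fst (x i)) \<inter> A \<notin> \<J>"
      by (simp only: mem_Collect_eq Collect_mem_eq not_False_eq_True)
    then have "f -` (\<Union>i. fst (x i)) \<inter> A \<notin> ideal_restrict \<J> A" using ideal_restrict_iff[OF J] by simp
    moreover have "finite (fst (x n)) \<and> fst (x n) \<inter> G n = {} \<and> card (fst (x n)) \<le> n" for n
    proof -
      have "finite (fst (x n))" "card (fst (x n)) \<le> n" "\<forall>e\<in>fst (x n). m n \<le> e"
        using leg[of n] unfolding unfolded_legal_def by simp_all
      moreover have "G n \<subseteq> {..<m n}" using bnd G unfolding m_def by blast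
      ultimately show ?thesis by fastforce
    qed
    ultimately show "(\<forall>n. finite (fst (\<tau> (map bnd (map G [0..<Suc n])))) \<and>
           fst (\<tau> (map bnd (map G [0..<Suc n]))) \<inter> G n = {} \<and>
           card (fst (\<tau> (map bnd (map G [0..<Suc n])))) \<le> length (map G [0..<n])) \<and>
         f -` (\<Union>n. fst (\<tau> (map bnd (map G [0..<Suc n])))) \<inter> A \<notin> ideal_restrict \<J> A"
      unfolding F by simp
  qed
  then show ?thesis unfolding player_I_wins_def by blast
qed

section \<open>Cardinal invariant and game for Borel ideals\<close>

theorem theorem5p7:
  fixes \<I> \<J> :: "nat set set"
  assumes "ideal_on UNIV \<I>" and "ideal_on UNIV \<J>"
    and "\<exists>\<S>. summable_ideal \<S> \<and> tall \<S> \<and> \<S> \<subseteq> \<I>"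
  shows "((\<forall>A f. A \<notin> \<J> \<and> ideal_to_one \<J> A f \<longrightarrow> player_I_wins \<J> A f) \<longrightarrow>
            cov_meager \<le>o fip \<I> \<J> UNIV) \<and>
         (borel_family \<J> \<and>
          (\<forall>A. A \<notin> \<J> \<longrightarrow>
             \<not> (\<exists>\<S>. summable_ideal \<S> \<and> tall \<S> \<and> katetov_above A (ideal_restrict \<J> A) \<S>)) \<longrightarrow>
            (\<forall>A f. A \<notin> \<J> \<and> ideal_to_one \<J> A f \<longrightarrow> player_I_wins \<J> A f) \<and>
            cov_meager \<le>o fip \<I> \<J> UNIV)"
proof -
  have cov: "cov_meager \<le>o fip \<I> \<J> UNIV"
    if "\<forall>A f. A \<notin> \<J> \<and> ideal_to_one \<J> A f \<longrightarrow> player_I_wins \<J> A f"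
    using cov_meager_le_fip[OF assms] that by blast
  have "player_I_wins \<J> A f"
    if "borel_family \<J>" "A \<notin> \<J>" "ideal_to_one \<J> A f"
      "\<forall>A. A \<notin> \<J> \<longrightarrow>
         \<not> (\<exists>\<S>. summable_ideal \<S> \<and> tall \<S> \<and> katetov_above A (ideal_restrict \<J> A) \<S>)" for A f
    using borel_player_I_wins[OF assms(2)] that by blast
  then show ?thesis using cov by blast
qed

end
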